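(* Let $\Omega$ be a bounded complete Reinhardt domain in $\mathbb C^n$. Then the following properties hold: (1) If $K_2(z,w)$ is not zero-free (i.e. $K_2(z,w)=0$ for some $z,w\in\Omega$), then there exists a positive integer $k_0$ such that the function $z\mapsto K_{2k}(z)$ is not real-analytic on $\Omega$ for any integer $k\ge k_0$. (2) Suppose there exist $\zeta_0,z_0\in\Omega$ such that $K_2(\zeta_0,z_0)=0$ and $\mathrm{ord}_{z_0}K_2(\zeta_0,\cdot)=1$. Then $z\mapsto K_{2k}(z)$ is not real-analytic on $\Omega$ for any integer $k>2$. Moreover, for any rational $p>2$, either $\mathrm{Re}\, m_p(\zeta_0,\cdot)$ or $\mathrm{Im}\, m_p(\zeta_0,\cdot)$ is not real-analytic on $\Omega$.
   Context: For a bounded domain $\Omega\subset\mathbb C^n$ and $p>0$, $A^p(\Omega)$ is the space of holomorphic functions $f$ on $\Omega$ with $\|f\|_p^p:=\int_\Omega|f|^p<\infty$ (Lebesgue measure). Put $m_p(z):=\inf\{\|f\|_p: f\in A^p(\Omega),\ f(z)=1\}$. For $p\ge1$ the infimum is attained by exactly one function, denoted $m_p(\cdot,z)$ (so $m_p(z,z)=1$, and $m_p(\zeta,z)$ is the value of this minimizer at $\zeta$). Set $K_p(z):=m_p(z)^{-p}$ for $p>0$ and $K_p(z,w):=m_p(z,w)K_p(w)$ for $p\ge1$; $K_2(z,w)$ is the usual Bergman kernel of $\Omega$ (holomorphic in $z$, anti-holomorphic in $w$). $\mathrm{ord}_{z_0}K_2(\zeta_0,\cdot)$ is the order of vanishing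 at $z_0$ of $w\mapsto K_2(\zeta_0,w)$ (equivalently of the holomorphic function $w\mapsto\overline{K_2(\zeta_0,w)}$). A domain $\Omega$ is complete Reinhardt if $z\in\Omega$ and $|w_j|\le|z_j|$ for all $j$ imply $w\in\Omega$. *)

theory Defs
  imports "HOL-Analysis.Analysis" "HOL-Library.Extended_Nat"
begin

text \<open>Holomorphy on an open subset of \<open>\<complex>\<^sup>n\<close>: total differentiability with complex-linear derivative.\<close>

definition holomorphic_Cn :: "(complex ^ 'n \<Rightarrow> complex) \<Rightarrow> (complex ^ 'n) set \<Rightarrow> bool"  (infix "holomorphic'_Cn'_on" 50)
  where "f holomorphic_Cn_on \<Omega> \<longleftrightarrow>
    (\<forall>z\<in>\<Omega>. \<exists>c :: complex ^ 'n. (f has_derivative (\<lambda>h. \<Sum>j\<in>UNIV. c $ j * h $ j)) (at z))"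

definition Lp_norm :: "(complex ^ 'n) set \<Rightarrow> real \<Rightarrow> (complex ^ 'n \<Rightarrow> complex) \<Rightarrow> real"
  where "Lp_norm \<Omega> p f = (LINT z:\<Omega>|lebesgue. norm (f z) powr p) powr (1 / p)"

definition bergman_space :: "(complex ^ 'n) set \<Rightarrow> real \<Rightarrow> (complex ^ 'n \<Rightarrow> complex) set"
  where "bergman_space \<Omega> p =
    {f. f holomorphic_Cn_on \<Omega> \<and> set_integrable lebesgue \<Omega> (\<lambda>z. norm (f z) powr p)}"

definition m_diag :: "(complex ^ 'n) set \<Rightarrow> real \<Rightarrow> complex ^ 'n \<Rightarrow> real"
  where "m_diag \<Omega> p z = Inf {Lp_norm \<Omega> p f | f. f \<in> bergman_space \<Omega> p \<and> f z = 1}"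

text \<open>The minimizer \<open>\<zeta> \<mapsto> m\<^sub>p(\<zeta>, z)\<close>, meaningful for \<open>p \<ge> 1\<close>. It is a function on \<open>\<Omega>\<close>;
  extensionality fixes its irrelevant values elsewhere, so that the description is unique.\<close>

definition m_off :: "(complex ^ 'n) set \<Rightarrow> real \<Rightarrow> complex ^ 'n \<Rightarrow> complex ^ 'n \<Rightarrow> complex"
  where "m_off \<Omega> p \<zeta> z =
    (THE f. f \<in> bergman_space \<Omega> p \<and> f \<in> extensional \<Omega> \<and> f z = 1 \<and> Lp_norm \<Omega> p f = m_diag \<Omega> p z) \<zeta>"

definition K_diag :: "(complex ^ 'n) set \<Rightarrow> real \<Rightarrow> complex ^ 'n \<Rightarrow> real"
  where "K_diag \<Omega> p z = m_diag \<Omega> p z powr (- p)"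

definition K_off :: "(complex ^ 'n) set \<Rightarrow> real \<Rightarrow> complex ^ 'n \<Rightarrow> complex ^ 'n \<Rightarrow> complex"
  where "K_off \<Omega> p z w = m_off \<Omega> p z w * of_real (K_diag \<Omega> p w)"

definition complete_reinhardt :: "(complex ^ 'n) set \<Rightarrow> bool"
  where "complete_reinhardt \<Omega> \<longleftrightarrow>
    (\<forall>z\<in>\<Omega>. \<forall>w. (\<forall>j. norm (w $ j) \<le> norm (z $ j)) \<longrightarrow> w \<in> \<Omega>)"

definition complex_partial :: "'n \<Rightarrow> (complex ^ 'n \<Rightarrow> complex) \<Rightarrow> complex ^ 'n \<Rightarrow> complex"
  where "complex_partial j f z = deriv (\<lambda>t. f (z + axis j t)) 0"

text \<open>Order of vanishing at \<open>z\<close> of a function holomorphic near \<open>z\<close>: the least order of a nonzero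
  iterated complex partial derivative at \<open>z\<close>, and \<open>\<infinity>\<close> if there is none.\<close>

definition vanishing_order :: "(complex ^ 'n \<Rightarrow> complex) \<Rightarrow> complex ^ 'n \<Rightarrow> enat"
  where "vanishing_order f z = (INF js\<in>{js. foldr complex_partial js f z \<noteq> 0}. enat (length js))"

text \<open>Real-analyticity on an open set: near every point \<open>a\<close>, \<open>f\<close> is the sum of an (absolutely)
  convergent power series in the real coordinates of \<open>x - a\<close>. Multi-indices are functions on
  \<open>Basis\<close>, set to \<open>0\<close> elsewhere. For \<open>complex ^ 'n\<close> the coordinates are the real and imaginary
  parts of the components.\<close>

definition real_analytic :: "('a::euclidean_space \<Rightarrow> real) \<Rightarrow> 'a set \<Rightarrow> bool"  (infix "real'_analytic'_on" 50)
  where "f real_analytic_on S \<longleftrightarrow>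
    (\<forall>a\<in>S. \<exists>r>0. \<exists>c :: ('a \<Rightarrow> nat) \<Rightarrow> real. \<forall>x\<in>ball a r.
      ((\<lambda>\<alpha>. c \<alpha> * (\<Prod>b\<in>Basis. ((x - a) \<bullet> b) ^ \<alpha> b)) has_sum f x) {\<alpha>. \<forall>b. b \<notin> Basis \<longrightarrow> \<alpha> b = 0})"

end

theory Submission
  imports Defs "HOL-Complex_Analysis.Conformal_Mappings"
begin

text \<open>The idea is to compare the kernels for different exponents near the origin, where they are explicitly related, and
to carry the relation to all of \<open>\<Omega>\<close> by analytic continuation, where it contradicts a zero of
\<open>K\<^sub>2\<close>. Write \<open>m(\<zeta>, z)\<close> for the minimizer \<open>m\<^sub>2(\<zeta>, z)\<close> and \<open>K = K\<^sub>2\<close>.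

Suppose \<open>m(\<cdot>, w)\<close> has a holomorphic power \<open>f = m(\<cdot>, w) ^ (2 / p)\<close> on \<open>\<Omega>\<close>, with \<open>p > 2\<close>. Then \<open>f\<close> is the
minimizer for the exponent \<open>p\<close>. Indeed, a competitor \<open>g\<close> for \<open>p\<close> yields the competitor
\<open>m(\<cdot>, w) ^ (1 - 2 / p) * g\<close> for the exponent two, and Young's inequality converts the minimality of \<open>m(\<cdot>, w)\<close>
into that of \<open>f\<close>; uniqueness is inherited in the same way (\<open>minimizer_of_Re_pos\<close>). Hence
\<open>K\<^sub>p(w) = K\<^sub>2(w)\<close> for such \<open>w\<close>.

Points \<open>w = t z\<close> with \<open>t > 0\<close> small are of this kind. Rotation invariance of Lebesgue measure and the maximum
principle give \<open>K(\<zeta>, t z) = K(t \<zeta>, z)\<close> (\<open>K_dilation\<close>). As \<open>\<Omega>\<close> is bounded, \<open>t \<zeta>\<close> stays close to \<open>0\<close> for all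
\<open>\<zeta> \<in> \<Omega>\<close> at once, and \<open>K(0, z) = K(0, 0) > 0\<close>; so \<open>m(\<cdot>, t z)\<close> has positive real part and the principal power
is available (\<open>Re_m_pos_near_zero\<close>). The same identity shows that \<open>K(t z, t z) = K(t\<^sup>2 z, z)\<close> extends
holomorphically in \<open>t\<close>. Therefore, if \<open>K\<^sub>p\<close> is real-analytic, then the equality of \<open>K\<^sub>p\<close> and \<open>K\<^sub>2\<close> propagates
along every segment from the origin, and \<open>K\<^sub>p = K\<^sub>2\<close> on \<open>\<Omega>\<close> (\<open>min_int_eq_of_real_analytic\<close>).

Let \<open>p = 2k\<close> and \<open>K\<^sub>p = K\<^sub>2\<close>. The \<open>k\<close>-th powers of an extremal sequence for \<open>p\<close> form an extremal sequence for the
exponent two, so they converge to \<open>m(\<cdot>, z)\<close>. Where \<open>m(\<cdot>, z)\<close> vanishes, a limit of \<open>k\<close>-th powers of uniformly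
bounded holomorphic functions vanishes to order at least \<open>k\<close> (\<open>m_vanishes_to_order\<close>). But the order of
a zero on the line through the origin is finite, because \<open>m(0, z) \<noteq> 0\<close>; this bounds \<open>k\<close>. If the order is one,
already \<open>k = 2\<close> is impossible.

For rational \<open>p = 2a/b\<close> the explicit formula near the origin reads
\<open>m\<^sub>p(\<zeta>, z) ^ a * K(z, z) ^ b = K(\<zeta>, z) ^ b\<close>. If \<open>m\<^sub>p(\<zeta>, \<cdot>)\<close> is real-analytic, this holds on \<open>\<Omega>\<close>
(\<open>m_off_power_eq\<close>). At a simple zero of \<open>K(\<zeta>, \<cdot>)\<close> the right-hand side decays, along a suitable line, exactly like the \<open>b\<close>-th power of
the distance, whereas the left-hand side decays at least like the \<open>a\<close>-th power, and \<open>a > b\<close>.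

The Hilbert space facts behind this (existence and uniqueness of the minimizer, reproducing property and
Hermitian symmetry of the kernel) rest on the mean value property over balls and on the theorem of Weierstrass
on locally uniform limits, in several variables.\<close>

section \<open>Lebesgue measure and isometries\<close>

text \<open>By the Vitali covering theorem an open set is, up to a null set, a disjoint union of balls. The preimage of a ball
is a ball of the same radius, hence of the same volume. Only one inequality comes out, because the preimage of the
null set is not controlled; applying it to the inverse as well gives equality.\<close>

lemma emeasure_open_le_vimage_isometry:
  fixes T T' :: "'a::euclidean_space \<Rightarrow> 'a"
  assumes dist: "\<And>x y. dist (T x) (T y) = dist x y"
    and inv: "\<And>x. T (T' x) = x"
    and U: "open U"
  shows "emeasure lborel U \<le> emeasure lborel (T -` U)"
proof -
  have ball: "T -` ball x r = ball (T' x) r" for x r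
    by (metis (no_types, lifting) dist inv mem_ball set_eqI vimage_eq)
  have contT: "continuous_on UNIV T"
    using dist by (auto simp: continuous_on_iff)
  have TU: "T -` U \<in> sets borel"
    using contT U by (simp add: open_vimage)
  define K where "K = {i. snd i > 0 \<and> ball (fst i) (snd i) \<subseteq> U}"
  have fine: "\<exists>i. i \<in> K \<and> x \<in> ball (fst i) (snd i) \<and> snd i < d" if "x \<in> U" "0 < d" for x d
  proof -
    obtain e where "e > 0" "ball x e \<subseteq> U"
      using U \<open>x \<in> U\<close> open_contains_ball by blast
    then have "ball x (min e (d/2)) \<subseteq> U" by auto
    then show ?thesis using \<open>e > 0\<close> \<open>d > 0\<close>
      by (intro exI[of _ "(x, min e (d/2))"]) (auto simp: K_def)
  qed
  obtain C where C: "countable C" "C \<subseteq> K"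
    "pairwise (\<lambda>i j. disjnt (ball (fst i) (snd i)) (ball (fst j) (snd j))) C"
    "negligible (U - (\<Union>i\<in>C. ball (fst i) (snd i)))"
    using Vitali_covering_theorem_balls[where K=K and a=fst and r=snd and S=U, OF fine]
    by (metis (no_types, lifting))
  let ?B = "\<lambda>i. ball (fst i) (snd i) :: 'a set"
  have disj: "disjoint_family_on ?B C"
    using C(3) by (auto simp: disjoint_family_on_def pairwise_def disjnt_def)
  have disj': "disjoint_family_on (\<lambda>i. T -` ?B i) C"
    using disj by (simp add: disjoint_family_on_def flip: vimage_Int)
  have BU: "(\<Union>i\<in>C. ?B i) \<subseteq> U" using C(2) unfolding K_def by blast
  have Bm: "(\<Union>i\<in>C. ?B i) \<in> sets borel" by (intro borel_open open_UN) auto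
  have "emeasure lborel (U - (\<Union>i\<in>C. ?B i)) = 0"
  proof -
    have "U - (\<Union>i\<in>C. ?B i) \<in> sets lborel" using U Bm by (intro sets.Diff) auto
    moreover have "emeasure lebesgue (U - (\<Union>i\<in>C. ?B i)) = 0"
      using C(4) negligible_iff_null_sets by blast
    ultimately show ?thesis by simp
  qed
  then have "emeasure lborel U = emeasure lborel (\<Union>i\<in>C. ?B i)"
    using emeasure_Diff_null_set[of "U - (\<Union>i\<in>C. ?B i)" lborel U] U Bm BU
    by (simp add: null_sets_def double_diff)
  also have "\<dots> = (\<integral>\<^sup>+i. emeasure lborel (?B i) \<partial>count_space C)"
    using C(1) disj by (intro emeasure_UN_countable) auto
  also have "\<dots> = (\<integral>\<^sup>+i. emeasure lborel (T -` ?B i) \<partial>count_space C)"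
    by (intro nn_integral_cong) (use C(2) in \<open>auto simp: ball emeasure_ball K_def\<close>)
  also have "\<dots> = emeasure lborel (\<Union>i\<in>C. T -` ?B i)"
    using C(1) disj' by (intro emeasure_UN_countable[symmetric]) (auto simp: ball)
  also have "\<dots> \<le> emeasure lborel (T -` U)"
    using BU TU by (intro emeasure_mono) auto
  finally show ?thesis .
qed

text \<open>The mean value property over balls and the circular symmetry of the kernel use this for
\<open>x \<mapsto> a + u (x - a)\<close> with \<open>\<bar>u\<bar> = 1\<close> on complex coordinate space.\<close>

lemma distr_lborel_isometry:
  fixes T T' :: "'a::euclidean_space \<Rightarrow> 'a"
  assumes dist: "\<And>x y. dist (T x) (T y) = dist x y"
    and inv: "\<And>x. T (T' x) = x" and inv': "\<And>x. T' (T x) = x"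
  shows "distr lborel borel T = lborel"
proof (rule lborel_eqI[symmetric])
  have dist': "dist (T' x) (T' y) = dist x y" for x y
    by (metis dist inv)
  have cont: "continuous_on UNIV T"
    using dist by (auto simp: continuous_on_iff)
  then have meas: "T \<in> borel_measurable borel" by (rule borel_measurable_continuous_onI)
  fix l u :: 'a assume le: "\<And>b. b \<in> Basis \<Longrightarrow> l \<bullet> b \<le> u \<bullet> b"
  have "emeasure lborel (T -` box l u) \<le> emeasure lborel (T' -` (T -` box l u))"
    by (rule emeasure_open_le_vimage_isometry[OF dist' inv']) (rule open_vimage[OF open_box cont])
  also have "T' -` (T -` box l u) = box l u" using inv by auto
  finally have "emeasure lborel (T -` box l u) = emeasure lborel (box l u)"
    using emeasure_open_le_vimage_isometry[OF dist inv open_box, of l u] by simp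
  then show "emeasure (distr lborel borel T) (box l u) = (\<Prod>b\<in>Basis. (u - l) \<bullet> b)"
    using meas le by (subst emeasure_distr) (auto simp: emeasure_lborel_box_eq)
qed simp

lemma integral_isometry_lebesgue_on:
  fixes T T' :: "'a::euclidean_space \<Rightarrow> 'a" and f :: "'a \<Rightarrow> 'b::{banach, second_countable_topology}"
  assumes dist: "\<And>x y. dist (T x) (T y) = dist x y"
    and inv: "\<And>x. T (T' x) = x" and inv': "\<And>x. T' (T x) = x"
    and S: "S \<in> sets borel" "\<And>x. T x \<in> S \<longleftrightarrow> x \<in> S"
    and f: "continuous_on S f"
  shows "integrable (lebesgue_on S) (\<lambda>x. f (T x)) \<longleftrightarrow> integrable (lebesgue_on S) f"
    and "integral\<^sup>L (lebesgue_on S) (\<lambda>x. f (T x)) = integral\<^sup>L (lebesgue_on S) f"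
proof -
  have cont: "continuous_on UNIV T"
    using dist by (auto simp: continuous_on_iff)
  then have T: "T \<in> borel_measurable borel" by (rule borel_measurable_continuous_onI)
  define g where "g = (\<lambda>x. indicator S x *\<^sub>R f x)"
  have g: "g \<in> borel_measurable borel"
    unfolding g_def using borel_measurable_continuous_on_indicator[OF S(1) f] .
  have gT: "(\<lambda>x. indicator S x *\<^sub>R f (T x)) = (\<lambda>x. g (T x))"
    using S(2) by (auto simp: g_def indicator_def)
  have SL: "S \<inter> space lebesgue \<in> sets lebesgue" using S(1) by auto
  have gTm: "(\<lambda>x. g (T x)) \<in> borel_measurable borel" using T g by measurable
  have 1: "integrable (lebesgue_on S) (\<lambda>x. f (T x)) \<longleftrightarrow> integrable lborel (\<lambda>x. g (T x))"
    using gTm by (simp add: integrable_restrict_space[OF SL] set_integrable_def gT integrable_completion)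
  have 2: "integrable (lebesgue_on S) f \<longleftrightarrow> integrable lborel g"
    using g by (simp add: integrable_restrict_space[OF SL] set_integrable_def g_def[symmetric] integrable_completion)
  have 3: "integral\<^sup>L (lebesgue_on S) (\<lambda>x. f (T x)) = integral\<^sup>L lborel (\<lambda>x. g (T x))"
    using gTm by (simp add: integral_restrict_space[OF SL] set_lebesgue_integral_def gT integral_completion)
  have 4: "integral\<^sup>L (lebesgue_on S) f = integral\<^sup>L lborel g"
    using g by (simp add: integral_restrict_space[OF SL] set_lebesgue_integral_def g_def[symmetric] integral_completion)
  have D: "distr lborel borel T = lborel" by (rule distr_lborel_isometry[OF dist inv inv'])
  have T': "T \<in> measurable lborel borel" using T by simp
  show "integrable (lebesgue_on S) (\<lambda>x. f (T x)) \<longleftrightarrow> integrable (lebesgue_on S) f"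
    using integrable_distr_eq[OF T' g] D 1 2 by simp
  show "integral\<^sup>L (lebesgue_on S) (\<lambda>x. f (T x)) = integral\<^sup>L (lebesgue_on S) f"
    using integral_distr[OF T' g] D 3 4 by simp
qed

section \<open>Holomorphic functions of several variables\<close>

lemma norm_vector_scalar_mult: "norm (u *s x) = norm u * norm (x :: complex ^ 'n)"
  by (simp add: norm_vec_def norm_mult L2_set_right_distrib)

lemma dist_vector_scalar_mult: "dist (u *s x) (u *s y) = norm u * dist x (y :: complex ^ 'n)"
  by (simp add: dist_norm flip: norm_vector_scalar_mult vector_ssub_ldistrib)

text \<open>Most one-variable arguments below take place on complex lines \<open>t \<mapsto> a + t h\<close>.\<close>

lemma has_derivative_complex_line:
  "((\<lambda>t. a + t *s h) has_derivative (\<lambda>t. t *s (h :: complex ^ 'n))) F"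
proof -
  have "bounded_linear (\<lambda>t. t *s h)"
    unfolding linear_conv_bounded_linear[symmetric]
    by (rule linearI) (simp_all add: vec_eq_iff algebra_simps)
  then show ?thesis
    by (auto intro!: derivative_eq_intros bounded_linear_imp_has_derivative)
qed

lemma continuous_on_complex_line: "continuous_on S (\<lambda>t. a + t *s (h :: complex ^ 'n))"
  using has_derivative_complex_line by (rule has_derivative_continuous_on)

lemma holomorphic_CnE:
  assumes "f holomorphic_Cn_on \<Omega>" "z \<in> \<Omega>"
  obtains c :: "complex ^ 'n" where "(f has_derivative (\<lambda>h. \<Sum>j\<in>UNIV. c $ j * h $ j)) (at z)"
  using assms unfolding holomorphic_Cn_def by blast

lemma holomorphic_CnI:
  assumes "\<And>z. z \<in> \<Omega> \<Longrightarrow> \<exists>c :: complex ^ 'n. \<exists>f'. (f has_derivative f') (at z) \<and> (\<forall>h. f' h = (\<Sum>j\<in>UNIV. c $ j * h $ j))"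
  shows "f holomorphic_Cn_on \<Omega>"
  unfolding holomorphic_Cn_def using assms
  by (metis (no_types, lifting) ext)

lemma holomorphic_Cn_const: "(\<lambda>z. c) holomorphic_Cn_on \<Omega>"
  by (rule holomorphic_CnI) (auto intro!: exI[of _ 0] derivative_intros)

lemma holomorphic_Cn_add:
  assumes "f holomorphic_Cn_on \<Omega>" "g holomorphic_Cn_on \<Omega>"
  shows "(\<lambda>z. f z + g z) holomorphic_Cn_on \<Omega>"
proof (rule holomorphic_CnI)
  fix z assume z: "z \<in> \<Omega>"
  obtain c where c: "(f has_derivative (\<lambda>h. \<Sum>j\<in>UNIV. c $ j * h $ j)) (at z)"
    by (rule holomorphic_CnE[OF assms(1) z])
  obtain d where d: "(g has_derivative (\<lambda>h. \<Sum>j\<in>UNIV. d $ j * h $ j)) (at z)"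
    by (rule holomorphic_CnE[OF assms(2) z])
  from has_derivative_add[OF c d]
  show "\<exists>c f'. ((\<lambda>z. f z + g z) has_derivative f') (at z) \<and> (\<forall>h. f' h = (\<Sum>j\<in>UNIV. c $ j * h $ j))"
    by (intro exI[of _ "c + d"] exI conjI) (auto simp: algebra_simps sum.distrib)
qed

lemma holomorphic_Cn_mult:
  assumes "f holomorphic_Cn_on \<Omega>" "g holomorphic_Cn_on \<Omega>"
  shows "(\<lambda>z. f z * g z) holomorphic_Cn_on \<Omega>"
proof (rule holomorphic_CnI)
  fix z assume z: "z \<in> \<Omega>"
  obtain c where c: "(f has_derivative (\<lambda>h. \<Sum>j\<in>UNIV. c $ j * h $ j)) (at z)"
    by (rule holomorphic_CnE[OF assms(1) z])
  obtain d where d: "(g has_derivative (\<lambda>h. \<Sum>j\<in>UNIV. d $ j * h $ j)) (at z)"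
    by (rule holomorphic_CnE[OF assms(2) z])
  from has_derivative_mult[OF c d]
  show "\<exists>c f'. ((\<lambda>z. f z * g z) has_derivative f') (at z) \<and> (\<forall>h. f' h = (\<Sum>j\<in>UNIV. c $ j * h $ j))"
    by (intro exI[of _ "\<chi> j. f z * d $ j + g z * c $ j"] exI conjI)
      (auto simp: algebra_simps sum.distrib sum_distrib_left)
qed

lemma holomorphic_Cn_cmult:
  "f holomorphic_Cn_on \<Omega> \<Longrightarrow> (\<lambda>z. a * f z) holomorphic_Cn_on \<Omega>"
  by (intro holomorphic_Cn_mult holomorphic_Cn_const)

lemma holomorphic_Cn_diff:
  assumes "f holomorphic_Cn_on \<Omega>" "g holomorphic_Cn_on \<Omega>"
  shows "(\<lambda>z. f z - g z) holomorphic_Cn_on \<Omega>"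
  using holomorphic_Cn_add[OF assms(1) holomorphic_Cn_cmult[OF assms(2), of "-1"]] by simp

lemma holomorphic_Cn_power:
  "f holomorphic_Cn_on \<Omega> \<Longrightarrow> (\<lambda>z. f z ^ k) holomorphic_Cn_on \<Omega>"
  by (induction k) (auto intro: holomorphic_Cn_mult holomorphic_Cn_const)

lemma holomorphic_Cn_compose:
  assumes f: "f holomorphic_Cn_on \<Omega>" and \<phi>: "\<phi> holomorphic_on S" "open S"
    and "\<And>z. z \<in> \<Omega> \<Longrightarrow> f z \<in> S"
  shows "(\<lambda>z. \<phi> (f z)) holomorphic_Cn_on \<Omega>"
proof (rule holomorphic_CnI)
  fix z assume z: "z \<in> \<Omega>"
  obtain c where c: "(f has_derivative (\<lambda>h. \<Sum>j\<in>UNIV. c $ j * h $ j)) (at z)"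
    by (rule holomorphic_CnE[OF f z])
  have "(\<phi> has_derivative (*) (deriv \<phi> (f z))) (at (f z))"
    using holomorphic_derivI[OF \<phi>] assms(4)[OF z] by (auto simp: has_field_derivative_def)
  from has_derivative_compose[OF c this]
  show "\<exists>c f'. ((\<lambda>z. \<phi> (f z)) has_derivative f') (at z) \<and> (\<forall>h. f' h = (\<Sum>j\<in>UNIV. c $ j * h $ j))"
    by (intro exI[of _ "\<chi> j. deriv \<phi> (f z) * c $ j"] exI conjI)
      (auto simp: algebra_simps sum_distrib_left)
qed

lemma holomorphic_Cn_scaled:
  assumes f: "f holomorphic_Cn_on \<Omega>" and "\<And>z. z \<in> \<Omega> \<Longrightarrow> u *s z \<in> \<Omega>"
  shows "(\<lambda>z. f (u *s z)) holomorphic_Cn_on \<Omega>"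
proof (rule holomorphic_CnI)
  fix z assume z: "z \<in> \<Omega>"
  obtain c where c: "(f has_derivative (\<lambda>h. \<Sum>j\<in>UNIV. c $ j * h $ j)) (at (u *s z))"
    by (rule holomorphic_CnE[OF f assms(2)[OF z]])
  have "bounded_linear (\<lambda>z :: complex ^ 'n. u *s z)"
    unfolding linear_conv_bounded_linear[symmetric]
    by (rule linearI) (simp_all add: vec_eq_iff algebra_simps)
  then have "((\<lambda>z. u *s z) has_derivative (\<lambda>z. u *s z)) (at z)"
    by (rule bounded_linear_imp_has_derivative)
  from has_derivative_compose[OF this c]
  show "\<exists>c f'. ((\<lambda>z. f (u *s z)) has_derivative f') (at z) \<and> (\<forall>h. f' h = (\<Sum>j\<in>UNIV. c $ j * h $ j))"
    by (intro exI[of _ "u *s c"] exI conjI) (auto simp: algebra_simps)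
qed

lemma holomorphic_Cn_transform:
  assumes "open \<Omega>" "f holomorphic_Cn_on \<Omega>" "\<And>z. z \<in> \<Omega> \<Longrightarrow> f z = g z"
  shows "g holomorphic_Cn_on \<Omega>"
proof (rule holomorphic_CnI)
  fix z assume z: "z \<in> \<Omega>"
  obtain c where c: "(f has_derivative (\<lambda>h. \<Sum>j\<in>UNIV. c $ j * h $ j)) (at z)"
    by (rule holomorphic_CnE[OF assms(2) z])
  have "(g has_derivative (\<lambda>h. \<Sum>j\<in>UNIV. c $ j * h $ j)) (at z)"
    using has_derivative_transform_within_open[OF c assms(1) z] assms(3) by blast
  then show "\<exists>c f'. (g has_derivative f') (at z) \<and> (\<forall>h. f' h = (\<Sum>j\<in>UNIV. c $ j * h $ j))"
    by blast
qed

lemma holomorphic_Cn_subset: "f holomorphic_Cn_on \<Omega> \<Longrightarrow> S \<subseteq> \<Omega> \<Longrightarrow> f holomorphic_Cn_on S"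
  unfolding holomorphic_Cn_def by blast

lemma holomorphic_Cn_imp_continuous_on:
  "f holomorphic_Cn_on \<Omega> \<Longrightarrow> continuous_on \<Omega> f"
  unfolding holomorphic_Cn_def
  by (metis continuous_at_imp_continuous_on has_derivative_continuous)

lemma has_field_derivative_complex_line:
  fixes c :: "complex ^ 'n"
  assumes "(f has_derivative (\<lambda>h. \<Sum>j\<in>UNIV. c $ j * h $ j)) (at (a + t *s h))"
  shows "((\<lambda>t. f (a + t *s h)) has_field_derivative (\<Sum>j\<in>UNIV. c $ j * h $ j)) (at t)"
proof -
  have "(\<lambda>x. \<Sum>j\<in>UNIV. c $ j * (x *s h) $ j) = (*) (\<Sum>j\<in>UNIV. c $ j * h $ j)"
    by (simp add: fun_eq_iff sum_distrib_left sum_distrib_right algebra_simps)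
  then show ?thesis
    unfolding has_field_derivative_def
    using has_derivative_compose[OF has_derivative_complex_line assms] by simp
qed

lemma holomorphic_on_complex_line:
  assumes "f holomorphic_Cn_on \<Omega>" "\<And>t. t \<in> S \<Longrightarrow> a + t *s h \<in> \<Omega>"
  shows "(\<lambda>t. f (a + t *s h)) holomorphic_on S"
  unfolding holomorphic_on_def field_differentiable_def
proof
  fix t assume "t \<in> S"
  then obtain c where "(f has_derivative (\<lambda>h. \<Sum>j\<in>UNIV. c $ j * h $ j)) (at (a + t *s h))"
    using holomorphic_CnE[OF assms(1) assms(2)] by blast
  from has_field_derivative_complex_line[OF this]
  show "\<exists>f'. ((\<lambda>t. f (a + t *s h)) has_field_derivative f') (at t within S)"
    using has_field_derivative_at_within by blast
qed

section \<open>Mean values over balls\<close>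

lemma holomorphic_circle_mean_value:
  assumes "f holomorphic_on cball 0 1"
  shows "(LINT s|lborel. indicator {0..1} s *\<^sub>R f (exp (2 * of_real pi * \<i> * of_real s))) = f 0"
proof -
  have "continuous_on {0..1::real} (\<lambda>s. f (exp (2 * of_real pi * \<i> * of_real s)))"
    by (rule continuous_on_compose2[OF holomorphic_on_imp_continuous_on[OF assms]])
      (auto intro!: continuous_intros)
  then have *: "set_integrable lborel {0..1} (\<lambda>s. f (exp (2 * of_real pi * \<i> * of_real s)))"
    unfolding set_integrable_def by (rule borel_integrable_compact[OF compact_Icc])
  have "((\<lambda>u. f u / (u - 0)) has_contour_integral (2 * of_real pi * \<i> * f 0)) (circlepath 0 1)"
    by (rule Cauchy_integral_circlepath_simple[OF assms]) simp
  then have "((\<lambda>s. 2 * of_real pi * \<i> * f (exp (2 * of_real pi * \<i> * of_real s))) has_integral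
      (2 * of_real pi * \<i> * f 0)) {0..1::real}"
    unfolding has_contour_integral_def
    by (rule has_integral_eq[rotated]) (subst vector_derivative_circlepath01; simp add: circlepath)
  then have "((\<lambda>s. (1 / (2 * of_real pi * \<i>)) * (2 * of_real pi * \<i> * f (exp (2 * of_real pi * \<i> * of_real s)))) has_integral
      ((1 / (2 * of_real pi * \<i>)) * (2 * of_real pi * \<i> * f 0))) {0..1::real}"
    by (rule has_integral_mult_right)
  then have "((\<lambda>s. f (exp (2 * of_real pi * \<i> * of_real s))) has_integral f 0) {0..1::real}"
    by simp
  then show ?thesis
    using set_borel_integral_eq_integral(2)[OF *] by (simp add: integral_unique set_lebesgue_integral_def)
qed

text \<open>On every circle \<open>{a + e (x - a) | \<bar>e\<bar> = 1}\<close> the mean of \<open>f\<close> is \<open>f a\<close>, by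
Cauchy's formula on the complex line through \<open>a\<close> and \<open>x\<close>. Averaging over \<open>x\<close> in the ball and exchanging the
integrals turns the circle means into ball integrals that are independent of \<open>e\<close>, by rotation invariance.\<close>

lemma integral_cball_mean_value:
  fixes f :: "complex ^ 'n \<Rightarrow> complex"
  assumes f: "f holomorphic_Cn_on \<Omega>" and B: "cball a r \<subseteq> \<Omega>" "r \<ge> 0"
  shows "integral\<^sup>L (lebesgue_on (cball a r)) f = of_real (measure lebesgue (cball a r)) * f a"
proof -
  define e :: "real \<Rightarrow> complex" where "e s = exp (2 * of_real pi * \<i> * of_real s)" for s
  have e1: "norm (e s) = 1" for s by (simp add: e_def)
  define T where "T u x = a + u *s (x - a)" for u and x :: "complex ^ 'n"
  have dT: "dist (T u x) (T u y) = norm u * dist x y" for u x y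
  proof -
    have "T u x - T u y = u *s (x - y)" by (simp add: T_def vec_eq_iff algebra_simps)
    then show ?thesis by (simp only: dist_norm norm_vector_scalar_mult)
  qed
  have TT: "T u (T v x) = T (u * v) x" for u v x
    by (simp add: T_def)
  have T1: "T 1 x = x" for x by (simp add: T_def)
  have Ta: "T u a = a" for u by (simp add: T_def)
  have TB: "T u x \<in> cball a r" if "norm u \<le> 1" "x \<in> cball a r" for u x
    using dT[of u a x] that mult_mono[of "norm u" 1 "dist a x" r] by (simp add: Ta)
  have TB': "T u x \<in> cball a r \<longleftrightarrow> x \<in> cball a r" if "norm u = 1" for u x
    using dT[of u a x] that by (simp add: Ta)
  have cont: "continuous_on (cball a r) f"
    using holomorphic_Cn_imp_continuous_on[OF f] B(1) continuous_on_subset by blast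
  have rot: "integral\<^sup>L (lebesgue_on (cball a r)) (\<lambda>x. f (T (e s) x)) = integral\<^sup>L (lebesgue_on (cball a r)) f" for s
  proof (rule integral_isometry_lebesgue_on(2)[where T'="T (cnj (e s))"])
    have "cnj (e s) * e s = 1" "e s * cnj (e s) = 1"
      using e1[of s] complex_norm_square[of "e s"] by (auto simp: mult.commute)
    then show "T (e s) (T (cnj (e s)) x) = x" "T (cnj (e s)) (T (e s) x) = x" for x
      by (simp_all only: TT T1)
  qed (use dT TB' e1 cont in auto)
  have contG: "continuous_on ({0..1} \<times> cball a r) (\<lambda>(s, x). f (T (e s) x))"
  proof -
    have "continuous_on ({0..1} \<times> cball a r) (\<lambda>p. T (e (fst p)) (snd p))"
      unfolding T_def e_def continuous_on_vec_lambda vector_scalar_mult_def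
      by (intro continuous_intros)
    then show ?thesis
      unfolding case_prod_unfold
      by (rule continuous_on_compose2[OF cont]) (use TB e1 in auto)
  qed
  have "integrable lborel (\<lambda>p. indicator ({0..1} \<times> cball a r) p *\<^sub>R (case p of (s, x) \<Rightarrow> f (T (e s) x)))"
    by (rule borel_integrable_compact[OF compact_Times contG]) auto
  then have int: "integrable (lborel \<Otimes>\<^sub>M lborel)
      (case_prod (\<lambda>s x. indicator {0..1::real} s *\<^sub>R indicator (cball a r) x *\<^sub>R f (T (e s) x)))"
    unfolding lborel_prod by (rule Bochner_Integration.integrable_cong[THEN iffD1, rotated -1])
      (auto simp: indicator_def)
  have circ: "(LINT s|lborel. indicator {0..1} s *\<^sub>R f (T (e s) x)) = f a" if "x \<in> cball a r" for x
  proof -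
    have "(\<lambda>t. f (T t x)) holomorphic_on cball 0 1"
      unfolding T_def by (rule holomorphic_on_complex_line[OF f]) (use TB that B in \<open>auto simp: T_def\<close>)
    from holomorphic_circle_mean_value[OF this] show ?thesis by (simp add: e_def T_def)
  qed
  have LB: "integral\<^sup>L (lebesgue_on (cball a r)) g = (LINT x|lborel. indicator (cball a r) x *\<^sub>R g x)"
    if "continuous_on (cball a r) g" for g :: "complex ^ 'n \<Rightarrow> complex"
  proof -
    have "(\<lambda>x. indicator (cball a r) x *\<^sub>R g x) \<in> borel_measurable borel"
      by (rule borel_measurable_continuous_on_indicator[OF _ that]) simp
    then show ?thesis
      by (simp add: integral_restrict_space set_lebesgue_integral_def integral_completion)
  qed
  have "integral\<^sup>L (lebesgue_on (cball a r)) f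
     = (LINT s|lborel. indicator {0..1::real} s *\<^sub>R integral\<^sup>L (lebesgue_on (cball a r)) f)"
    by simp
  also have "\<dots> = (LINT s|lborel. indicator {0..1::real} s *\<^sub>R (LINT x|lborel. indicator (cball a r) x *\<^sub>R f (T (e s) x)))"
  proof (rule Bochner_Integration.integral_cong[OF refl])
    fix s
    have "continuous_on (cball a r) (\<lambda>x. f (T (e s) x))"
      by (rule continuous_on_compose2[OF cont])
        (use TB e1 in \<open>auto simp: T_def vector_scalar_mult_def intro!: continuous_intros\<close>)
    then show "indicator {0..1::real} s *\<^sub>R integral\<^sup>L (lebesgue_on (cball a r)) f
      = indicator {0..1::real} s *\<^sub>R (LINT x|lborel. indicator (cball a r) x *\<^sub>R f (T (e s) x))"
      using rot[of s] LB by metis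
  qed
  also have "\<dots> = (LINT s|lborel. LINT x|lborel. indicator {0..1::real} s *\<^sub>R indicator (cball a r) x *\<^sub>R f (T (e s) x))"
    by (simp only: integral_scaleR_right)
  also have "\<dots> = (LINT x|lborel. LINT s|lborel. indicator {0..1::real} s *\<^sub>R indicator (cball a r) x *\<^sub>R f (T (e s) x))"
    by (rule lborel_pair.Fubini_integral[OF int, symmetric])
  also have "\<dots> = (LINT x|lborel. indicator (cball a r) x *\<^sub>R f a)"
  proof (rule Bochner_Integration.integral_cong[OF refl])
    fix x
    have "(LINT s|lborel. indicator {0..1::real} s *\<^sub>R indicator (cball a r) x *\<^sub>R f (T (e s) x))
      = indicator (cball a r) x *\<^sub>R (LINT s|lborel. indicator {0..1::real} s *\<^sub>R f (T (e s) x))"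
      by (subst integral_scaleR_right[symmetric]) (simp add: mult.commute)
    then show "(LINT s|lborel. indicator {0..1::real} s *\<^sub>R indicator (cball a r) x *\<^sub>R f (T (e s) x))
      = indicator (cball a r) x *\<^sub>R f a"
      using circ by (auto simp: indicator_def)
  qed
  also have "\<dots> = of_real (measure lebesgue (cball a r)) * f a"
    by (simp add: scaleR_conv_of_real)
  finally show ?thesis .
qed

section \<open>Locally uniform limits\<close>

lemma norm_deriv_bound:
  assumes "f holomorphic_on ball a r" "0 < r" "\<And>z. z \<in> ball a r \<Longrightarrow> norm (f z) \<le> B"
  shows "norm (deriv f a) \<le> 2 * B / r"
proof -
  have "norm ((deriv ^^ 1) f a) \<le> fact 1 * B / (r/2) ^ 1"
  proof (rule Cauchy_inequality)
    show "f holomorphic_on ball a (r/2)" "continuous_on (cball a (r/2)) f"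
      using assms(1,2) by (auto intro!: holomorphic_on_imp_continuous_on elim!: holomorphic_on_subset)
  qed (use assms(2,3) in \<open>auto simp: dist_norm\<close>)
  then show ?thesis by (simp add: field_simps)
qed

text \<open>Cauchy's estimate on the complex line in the direction of the \<open>j\<close>-th coordinate.\<close>

lemma gradient_bound:
  fixes c :: "complex ^ 'n"
  assumes f: "f holomorphic_Cn_on ball a r" and r: "r > 0" and B: "\<And>z. z \<in> ball a r \<Longrightarrow> norm (f z) \<le> B"
    and c: "(f has_derivative (\<lambda>h. \<Sum>j\<in>UNIV. c $ j * h $ j)) (at a)"
  shows "norm (c $ j) \<le> 2 * B / r"
proof -
  have in_ball: "a + t *s axis j 1 \<in> ball a r" if "t \<in> ball 0 r" for t
    using that by (simp add: dist_norm norm_vector_scalar_mult)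
  have "((\<lambda>t. f (a + t *s axis j 1)) has_field_derivative (\<Sum>i\<in>UNIV. c $ i * axis j 1 $ i)) (at 0)"
    by (rule has_field_derivative_complex_line) (use c in simp)
  also have "(\<Sum>i\<in>UNIV. c $ i * axis j 1 $ i) = c $ j"
    by (simp add: axis_def if_distrib cong: if_cong)
  finally have "deriv (\<lambda>t. f (a + t *s axis j 1)) 0 = c $ j"
    by (rule DERIV_imp_deriv)
  moreover have "norm (deriv (\<lambda>t. f (a + t *s axis j 1)) 0) \<le> 2 * B / r"
    by (rule norm_deriv_bound[OF holomorphic_on_complex_line[OF f]]) (use r in_ball B in auto)
  ultimately show ?thesis by simp
qed

text \<open>Weierstrass' theorem in several variables: by Cauchy's estimate the gradients are again uniformly Cauchy on a
smaller ball, so that the derivative may be taken under the limit, and a limit of complex-linear forms is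
complex-linear.\<close>

lemma holomorphic_Cn_uniform_limit:
  fixes f :: "nat \<Rightarrow> complex ^ 'n \<Rightarrow> complex"
  assumes "open \<Omega>" and f: "\<And>n. f n holomorphic_Cn_on \<Omega>"
    and lim: "\<And>z. z \<in> \<Omega> \<Longrightarrow> (\<lambda>n. f n z) \<longlonglongrightarrow> g z"
    and unif: "\<And>a. a \<in> \<Omega> \<Longrightarrow> \<exists>r>0. ball a r \<subseteq> \<Omega> \<and> uniformly_Cauchy_on (ball a r) f"
  shows "g holomorphic_Cn_on \<Omega>"
proof (rule holomorphic_CnI)
  fix a assume a: "a \<in> \<Omega>"
  obtain r where r: "r > 0" "ball a r \<subseteq> \<Omega>" and uc: "uniformly_Cauchy_on (ball a r) f"
    using unif[OF a] by blast
  have "\<exists>c :: complex ^ 'n. (f n has_derivative (\<lambda>h. \<Sum>j\<in>UNIV. c $ j * h $ j)) (at z)" if "z \<in> \<Omega>" for n z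
    using f that unfolding holomorphic_Cn_def by blast
  note ex = this
  define c where "c n z = (SOME c. (f n has_derivative (\<lambda>h. \<Sum>j\<in>UNIV. c $ j * h $ j)) (at z))" for n z
  have c: "(f n has_derivative (\<lambda>h. \<Sum>j\<in>UNIV. c n z $ j * h $ j)) (at z)" if "z \<in> \<Omega>" for n z
    unfolding c_def by (rule someI_ex) (rule ex[OF that])
  have sub: "ball z (r/2) \<subseteq> ball a r" if "z \<in> ball a (r/2)" for z
    using that by (smt (verit) dist_triangle mem_ball subsetI field_sum_of_halves)
  have cC: "norm (c m z $ j - c n z $ j) \<le> 4 * e / r"
    if z: "z \<in> ball a (r/2)" and e: "\<And>x. x \<in> ball a r \<Longrightarrow> dist (f m x) (f n x) \<le> e" for m n z e j
  proof -
    have "norm ((c m z - c n z) $ j) \<le> 2 * e / (r / 2)"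
    proof (rule gradient_bound[of "\<lambda>x. f m x - f n x"])
      show "(\<lambda>x. f m x - f n x) holomorphic_Cn_on ball z (r/2)"
        by (rule holomorphic_Cn_subset[OF holomorphic_Cn_diff[OF f f]]) (use sub[OF z] r(2) in blast)
      show "norm (f m x - f n x) \<le> e" if "x \<in> ball z (r/2)" for x
        using e[of x] that sub[OF z] by (auto simp: dist_norm)
      have "z \<in> \<Omega>" using z r by auto
      from has_derivative_diff[OF c[OF this, of m] c[OF this, of n]]
      show "((\<lambda>x. f m x - f n x) has_derivative (\<lambda>h. \<Sum>j\<in>UNIV. (c m z - c n z) $ j * h $ j)) (at z)"
        by (simp add: sum_subtractf algebra_simps)
    qed (use r in auto)
    then show ?thesis by simp
  qed
  have "uniformly_Cauchy_on (ball a (r/2)) (\<lambda>n z. c n z $ j)" for j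
    unfolding uniformly_Cauchy_on_def
  proof (intro allI impI)
    fix e :: real assume "e > 0"
    then have "e * r / 8 > 0" using r by simp
    with uc obtain M where M: "\<And>x m n. x \<in> ball a r \<Longrightarrow> m \<ge> M \<Longrightarrow> n \<ge> M \<Longrightarrow> dist (f m x) (f n x) < e * r / 8"
      unfolding uniformly_Cauchy_on_def by metis
    show "\<exists>M. \<forall>x\<in>ball a (r/2). \<forall>m\<ge>M. \<forall>n\<ge>M. dist (c m x $ j) (c n x $ j) < e"
    proof (intro exI[of _ M] ballI allI impI)
      fix x m n assume *: "x \<in> ball a (r/2)" "M \<le> m" "M \<le> n"
      have "norm (c m x $ j - c n x $ j) \<le> 4 * (e * r / 8) / r"
        using * M by (intro cC) (auto intro: less_imp_le)
      also have "\<dots> < e" using r \<open>e > 0\<close> by simp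
      finally show "dist (c m x $ j) (c n x $ j) < e" by (simp add: dist_norm)
    qed
  qed
  then have "\<exists>l. uniform_limit (ball a (r/2)) (\<lambda>n z. c n z $ j) l sequentially" for j
    using Cauchy_uniformly_convergent unfolding uniformly_convergent_on_def by blast
  then obtain l where l: "\<And>j. uniform_limit (ball a (r/2)) (\<lambda>n z. c n z $ j) (l j) sequentially"
    by metis
  define N where "N = real CARD('n)"
  have N: "N > 0" by (simp add: N_def)
  have "\<exists>g'. \<forall>x\<in>ball a (r/2). (\<lambda>n. f n x) \<longlonglongrightarrow> g' x \<and>
       (g' has_derivative (\<lambda>h. \<Sum>j\<in>UNIV. l j x * h $ j)) (at x within ball a (r/2))"
  proof (rule has_derivative_sequence[where f=f and f'="\<lambda>n x h. \<Sum>j\<in>UNIV. c n x $ j * h $ j"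
        and g'="\<lambda>x h. \<Sum>j\<in>UNIV. l j x * h $ j" and ?x0.0=a and l="g a"])
    show "(f n has_derivative (\<lambda>h. \<Sum>j\<in>UNIV. c n x $ j * h $ j)) (at x within ball a (r/2))"
      if "x \<in> ball a (r/2)" for n x
      by (rule has_derivative_at_withinI[OF c]) (use that r in auto)
    fix e :: real assume e: "e > 0"
    have "\<forall>\<^sub>F n in sequentially. \<forall>j. \<forall>x\<in>ball a (r/2). dist (c n x $ j) (l j x) < e / N"
      by (intro eventually_all_finite uniform_limitD[OF l]) (use e N in auto)
    then show "\<forall>\<^sub>F n in sequentially. \<forall>x\<in>ball a (r/2). \<forall>h.
        norm ((\<Sum>j\<in>UNIV. c n x $ j * h $ j) - (\<Sum>j\<in>UNIV. l j x * h $ j)) \<le> e * norm h"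
    proof (rule eventually_mono, intro ballI allI)
      fix n x and h :: "complex ^ 'n"
      assume *: "\<forall>j. \<forall>x\<in>ball a (r/2). dist (c n x $ j) (l j x) < e / N" and x: "x \<in> ball a (r/2)"
      have "norm ((\<Sum>j\<in>UNIV. c n x $ j * h $ j) - (\<Sum>j\<in>UNIV. l j x * h $ j))
          = norm (\<Sum>j\<in>UNIV. (c n x $ j - l j x) * h $ j)"
        by (simp add: sum_subtractf algebra_simps)
      also have "\<dots> \<le> (\<Sum>j\<in>(UNIV::'n set). (e / N) * norm h)"
      proof (rule sum_norm_le)
        fix j :: 'n
        have "norm (c n x $ j - l j x) \<le> e / N"
          using * x by (simp add: dist_norm less_imp_le)
        then show "norm ((c n x $ j - l j x) * h $ j) \<le> (e / N) * norm h"
          unfolding norm_mult using e N by (intro mult_mono Finite_Cartesian_Product.norm_nth_le) auto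
      qed
      also have "\<dots> = e * norm h" using N by (simp add: N_def)
      finally show "norm ((\<Sum>j\<in>UNIV. c n x $ j * h $ j) - (\<Sum>j\<in>UNIV. l j x * h $ j)) \<le> e * norm h" .
    qed
  qed (use r lim[OF a] in auto)
  then obtain g' where g': "\<And>x. x \<in> ball a (r/2) \<Longrightarrow> (\<lambda>n. f n x) \<longlonglongrightarrow> g' x"
     "\<And>x. x \<in> ball a (r/2) \<Longrightarrow> (g' has_derivative (\<lambda>h. \<Sum>j\<in>UNIV. l j x * h $ j)) (at x within ball a (r/2))"
    by blast
  have eq: "g' x = g x" if "x \<in> ball a (r/2)" for x
  proof -
    have "x \<in> ball a r" using that r(1) by auto
    then show ?thesis using LIMSEQ_unique[OF g'(1)[OF that] lim] r(2) by blast
  qed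
  have "(g' has_derivative (\<lambda>h. \<Sum>j\<in>UNIV. l j a * h $ j)) (at a)"
    using g'(2)[of a] r at_within_open[of a "ball a (r/2)"] by simp
  then have "(g has_derivative (\<lambda>h. \<Sum>j\<in>UNIV. l j a * h $ j)) (at a)"
    by (rule has_derivative_transform_within_open[of _ _ _ _ "ball a (r/2)"]) (use r eq in auto)
  then show "\<exists>c f'. (g has_derivative f') (at a) \<and> (\<forall>h. f' h = (\<Sum>j\<in>UNIV. c $ j * h $ j))"
    by (intro exI[of _ "\<chi> j. l j a"] exI conjI) auto
qed

section \<open>Minimal integrals in Bergman spaces\<close>

lemma holomorphic_Cn_measurable:
  assumes "f holomorphic_Cn_on \<Omega>" "open \<Omega>"
  shows "f \<in> borel_measurable (lebesgue_on \<Omega>)"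
  by (rule continuous_imp_measurable_on_sets_lebesgue[OF holomorphic_Cn_imp_continuous_on[OF assms(1)]])
    (use assms(2) in auto)

locale bounded_open_set =
  fixes \<Omega> :: "(complex ^ 'n) set"
  assumes open_\<Omega>: "open \<Omega>" and bounded_\<Omega>: "bounded \<Omega>"
begin

text \<open>Working with the integral \<open>\<parallel>f\<parallel>\<^sub>p\<^sup>p\<close> and its minimum, rather than with the norm, avoids roots: on competitors that are powers
of one another the integrals for different exponents agree literally.\<close>

definition Lp_int :: "real \<Rightarrow> (complex ^ 'n \<Rightarrow> complex) \<Rightarrow> real"
  where "Lp_int p f = integral\<^sup>L (lebesgue_on \<Omega>) (\<lambda>z. norm (f z) powr p)"

text \<open>This is \<open>m\<^sub>p(z)\<^sup>p = 1 / K\<^sub>p(z)\<close>, the infimum of \<open>\<parallel>f\<parallel>\<^sub>p\<^sup>p\<close> under the constraint \<open>f z = 1\<close>.\<close>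

definition min_int :: "real \<Rightarrow> complex ^ 'n \<Rightarrow> real"
  where "min_int p z = m_diag \<Omega> p z powr p"

lemma \<Omega>_sets: "\<Omega> \<inter> space lebesgue \<in> sets lebesgue"
  using open_\<Omega> by auto

lemma finite_measure_\<Omega>: "finite_measure (lebesgue_on \<Omega>)"
proof (rule finite_measureI)
  have "\<Omega> \<in> lmeasurable"
    using open_\<Omega> bounded_\<Omega> by (simp add: lmeasurable_open)
  then show "emeasure (lebesgue_on \<Omega>) (space (lebesgue_on \<Omega>)) \<noteq> \<infinity>"
    using open_\<Omega> fmeasurableD2[of \<Omega> lebesgue]
    by (simp add: emeasure_restrict_space del: emeasure_completion)
qed

lemma bergman_space_iff:
  "f \<in> bergman_space \<Omega> p \<longleftrightarrow>
    f holomorphic_Cn_on \<Omega> \<and> integrable (lebesgue_on \<Omega>) (\<lambda>z. norm (f z) powr p)"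
  by (simp add: bergman_space_def integrable_restrict_space[OF \<Omega>_sets] set_integrable_def)

lemma Lp_norm_eq: "Lp_norm \<Omega> p f = Lp_int p f powr (1 / p)"
  by (simp add: Lp_norm_def Lp_int_def integral_restrict_space[OF \<Omega>_sets] set_lebesgue_integral_def)

lemma Lp_int_nonneg: "Lp_int p f \<ge> 0"
  by (simp add: Lp_int_def)

lemma Lp_int_cong: "(\<And>z. z \<in> \<Omega> \<Longrightarrow> f z = g z) \<Longrightarrow> Lp_int p f = Lp_int p g"
  unfolding Lp_int_def by (rule Bochner_Integration.integral_cong) auto

lemma bergman_space_cong:
  "f \<in> bergman_space \<Omega> p \<Longrightarrow> (\<And>z. z \<in> \<Omega> \<Longrightarrow> f z = g z) \<Longrightarrow> g \<in> bergman_space \<Omega> p"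
  unfolding bergman_space_iff
  using holomorphic_Cn_transform[OF open_\<Omega>, of f g]
    Bochner_Integration.integrable_cong[of "lebesgue_on \<Omega>" "lebesgue_on \<Omega>" "\<lambda>z. norm (f z) powr p" "\<lambda>z. norm (g z) powr p"]
  by auto

lemma bergman_space_bound:
  assumes "f holomorphic_Cn_on \<Omega>" "integrable (lebesgue_on \<Omega>) g"
    "\<And>z. z \<in> \<Omega> \<Longrightarrow> norm (f z) powr p \<le> g z"
  shows "f \<in> bergman_space \<Omega> p"
  unfolding bergman_space_iff
proof
  show "integrable (lebesgue_on \<Omega>) (\<lambda>z. norm (f z) powr p)"
    using assms(2)
  proof (rule Bochner_Integration.integrable_bound)
    show "(\<lambda>z. norm (f z) powr p) \<in> borel_measurable (lebesgue_on \<Omega>)"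
      using holomorphic_Cn_measurable[OF assms(1) open_\<Omega>] by measurable
    show "AE z in lebesgue_on \<Omega>. norm (norm (f z) powr p) \<le> norm (g z)"
      by (rule AE_I2) (use assms(3) in \<open>auto intro: order_trans[OF _ abs_ge_self]\<close>)
  qed
qed (fact assms(1))

lemma one_in_bergman_space: "(\<lambda>z. 1) \<in> bergman_space \<Omega> p"
  by (rule bergman_space_bound[OF holomorphic_Cn_const, of "\<lambda>_. 1"])
    (use finite_measure.integrable_const[OF finite_measure_\<Omega>] in auto)

lemma m_diag_le_Lp_norm:
  assumes "f \<in> bergman_space \<Omega> p" "f z = 1"
  shows "m_diag \<Omega> p z \<le> Lp_norm \<Omega> p f"
  unfolding m_diag_def by (rule cInf_lower) (use assms in \<open>auto intro!: bdd_belowI[of _ 0] simp: Lp_norm_def\<close>)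

lemma m_diag_approx:
  assumes "\<epsilon> > m_diag \<Omega> p z"
  obtains f where "f \<in> bergman_space \<Omega> p" "f z = 1" "Lp_norm \<Omega> p f < \<epsilon>"
proof -
  have "Inf {Lp_norm \<Omega> p f | f. f \<in> bergman_space \<Omega> p \<and> f z = 1} < \<epsilon>"
    using assms by (simp add: m_diag_def)
  from cInf_lessD[OF _ this] one_in_bergman_space that show ?thesis by blast
qed

lemma m_diag_nonneg: "m_diag \<Omega> p z \<ge> 0"
  unfolding m_diag_def
  by (rule cInf_greatest) (use one_in_bergman_space in \<open>auto simp: Lp_norm_def\<close>)

lemma min_int_nonneg: "min_int p z \<ge> 0"
  by (simp add: min_int_def)

lemma Lp_norm_powr: "p > 0 \<Longrightarrow> Lp_norm \<Omega> p f powr p = Lp_int p f"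
  by (simp add: Lp_norm_eq powr_powr Lp_int_nonneg)

lemma min_int_le:
  assumes "p > 0" "f \<in> bergman_space \<Omega> p" "f z = 1"
  shows "min_int p z \<le> Lp_int p f"
proof -
  have "min_int p z \<le> Lp_norm \<Omega> p f powr p"
    unfolding min_int_def using assms by (intro powr_mono2 m_diag_le_Lp_norm m_diag_nonneg) auto
  then show ?thesis using assms(1) by (simp add: Lp_norm_powr)
qed

lemma m_diag_eq: "p > 0 \<Longrightarrow> m_diag \<Omega> p z = min_int p z powr (1 / p)"
  by (simp add: min_int_def powr_powr m_diag_nonneg)

lemma min_int_approx:
  assumes "p > 0" "\<epsilon> > min_int p z"
  obtains f where "f \<in> bergman_space \<Omega> p" "f z = 1" "Lp_int p f < \<epsilon>"
proof -
  have "m_diag \<Omega> p z < \<epsilon> powr (1 / p)"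
    using assms min_int_nonneg[of p z] by (simp add: m_diag_eq powr_less_mono2)
  then obtain f where f: "f \<in> bergman_space \<Omega> p" "f z = 1" "Lp_norm \<Omega> p f < \<epsilon> powr (1 / p)"
    by (rule m_diag_approx)
  have "Lp_norm \<Omega> p f powr p < (\<epsilon> powr (1 / p)) powr p"
    using f(3) assms(1) by (intro powr_less_mono2) (auto simp: Lp_norm_def)
  also have "\<dots> = \<epsilon>"
    using assms min_int_nonneg[of p z] by (simp add: powr_powr)
  finally have "Lp_int p f < \<epsilon>" using assms(1) by (simp add: Lp_norm_powr)
  with f that show ?thesis by blast
qed

lemma min_int_eqI:
  assumes "p > 0" "f \<in> bergman_space \<Omega> p" "f z = 1"
    and "\<And>g. g \<in> bergman_space \<Omega> p \<Longrightarrow> g z = 1 \<Longrightarrow> Lp_int p f \<le> Lp_int p g"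
  shows "min_int p z = Lp_int p f"
proof (rule antisym[OF min_int_le[OF assms(1-3)]], rule ccontr)
  assume "\<not> Lp_int p f \<le> min_int p z"
  then obtain g where "g \<in> bergman_space \<Omega> p" "g z = 1" "Lp_int p g < Lp_int p f"
    using min_int_approx[OF assms(1), of z "Lp_int p f"] by auto
  with assms(4) show False by fastforce
qed

lemma Lp_norm_eq_m_diag_iff: "p > 0 \<Longrightarrow> Lp_norm \<Omega> p f = m_diag \<Omega> p z \<longleftrightarrow> Lp_int p f = min_int p z"
  by (metis Lp_int_nonneg Lp_norm_eq Lp_norm_powr min_int_def m_diag_eq)

lemma K_diag_eq: "K_diag \<Omega> p z = inverse (min_int p z)"
  by (simp add: K_diag_def min_int_def powr_minus)

text \<open>The definite description in \<open>m_off\<close> ranges over extensional functions, so it denotes the restriction of a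
minimizer that is unique as a function on \<open>\<Omega>\<close>.\<close>

lemma m_off_eqI:
  assumes p: "p > 0" and f: "f \<in> bergman_space \<Omega> p" "f z = 1" "Lp_int p f = min_int p z"
    and uniq: "\<And>g \<zeta>. g \<in> bergman_space \<Omega> p \<Longrightarrow> g z = 1 \<Longrightarrow> Lp_int p g = min_int p z \<Longrightarrow> \<zeta> \<in> \<Omega> \<Longrightarrow> g \<zeta> = f \<zeta>"
    and "z \<in> \<Omega>" "\<zeta> \<in> \<Omega>"
  shows "m_off \<Omega> p \<zeta> z = f \<zeta>"
proof -
  let ?P = "\<lambda>f. f \<in> bergman_space \<Omega> p \<and> f \<in> extensional \<Omega> \<and> f z = 1 \<and> Lp_norm \<Omega> p f = m_diag \<Omega> p z"
  have "(THE f. ?P f) = restrict f \<Omega>"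
  proof (rule the_equality)
    have "Lp_int p (restrict f \<Omega>) = min_int p z"
      using f(3) Lp_int_cong[of f "restrict f \<Omega>"] by simp
    then show "?P (restrict f \<Omega>)"
      using f bergman_space_cong[OF f(1), of "restrict f \<Omega>"] p \<open>z \<in> \<Omega>\<close>
      by (simp add: Lp_norm_eq_m_diag_iff)
  next
    fix g assume "?P g"
    then show "g = restrict f \<Omega>"
      using uniq[of g] p by (intro extensionalityI[of _ \<Omega>]) (auto simp: Lp_norm_eq_m_diag_iff)
  qed
  then show ?thesis using \<open>\<zeta> \<in> \<Omega>\<close> by (simp add: m_off_def)
qed

section \<open>The Hilbert space structure for exponent two\<close>

abbreviation A2 :: "(complex ^ 'n \<Rightarrow> complex) set" where "A2 \<equiv> bergman_space \<Omega> 2"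

definition L2_inner :: "(complex ^ 'n \<Rightarrow> complex) \<Rightarrow> (complex ^ 'n \<Rightarrow> complex) \<Rightarrow> complex"
  where "L2_inner f g = integral\<^sup>L (lebesgue_on \<Omega>) (\<lambda>z. f z * cnj (g z))"

lemma A2_iff: "f \<in> A2 \<longleftrightarrow> f holomorphic_Cn_on \<Omega> \<and> integrable (lebesgue_on \<Omega>) (\<lambda>z. (norm (f z))\<^sup>2)"
  by (simp add: bergman_space_iff)

lemma Lp_int2_eq: "Lp_int 2 f = integral\<^sup>L (lebesgue_on \<Omega>) (\<lambda>z. (norm (f z))\<^sup>2)"
  by (simp add: Lp_int_def)

lemma A2_cmult: "f \<in> A2 \<Longrightarrow> (\<lambda>z. c * f z) \<in> A2"
  by (auto simp: A2_iff norm_mult power_mult_distrib intro: holomorphic_Cn_cmult)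

lemma A2_add:
  assumes "f \<in> A2" "g \<in> A2" shows "(\<lambda>z. f z + g z) \<in> A2"
proof (rule bergman_space_bound)
  show "integrable (lebesgue_on \<Omega>) (\<lambda>z. 2 * (norm (f z))\<^sup>2 + 2 * (norm (g z))\<^sup>2)"
    using assms by (auto simp: A2_iff)
  fix z
  have "(norm (f z + g z))\<^sup>2 \<le> (norm (f z) + norm (g z))\<^sup>2"
    by (intro power_mono norm_triangle_ineq) auto
  also have "\<dots> \<le> 2 * (norm (f z))\<^sup>2 + 2 * (norm (g z))\<^sup>2"
    using zero_le_power2[of "norm (f z) - norm (g z)"] by (simp add: power2_eq_square algebra_simps)
  finally show "norm (f z + g z) powr 2 \<le> 2 * (norm (f z))\<^sup>2 + 2 * (norm (g z))\<^sup>2" by simp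
qed (use assms in \<open>auto simp: A2_iff intro: holomorphic_Cn_add\<close>)

lemma A2_diff: "f \<in> A2 \<Longrightarrow> g \<in> A2 \<Longrightarrow> (\<lambda>z. f z - g z) \<in> A2"
  using A2_add[OF _ A2_cmult[of g "-1"], of f] by simp

lemma A2_mult_cnj_integrable:
  assumes "f \<in> A2" "g \<in> A2"
  shows "integrable (lebesgue_on \<Omega>) (\<lambda>z. f z * cnj (g z))"
proof (rule Bochner_Integration.integrable_bound)
  show "integrable (lebesgue_on \<Omega>) (\<lambda>z. (norm (f z))\<^sup>2 + (norm (g z))\<^sup>2)"
    using assms by (auto simp: A2_iff)
  have "f \<in> borel_measurable (lebesgue_on \<Omega>)" "g \<in> borel_measurable (lebesgue_on \<Omega>)"
    using assms by (auto simp: A2_iff intro: holomorphic_Cn_measurable open_\<Omega>)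
  then show "(\<lambda>z. f z * cnj (g z)) \<in> borel_measurable (lebesgue_on \<Omega>)"
    by (intro borel_measurable_times borel_measurable_continuous_on[of cnj]) (auto intro!: continuous_intros)
  show "AE z in lebesgue_on \<Omega>. norm (f z * cnj (g z)) \<le> norm ((norm (f z))\<^sup>2 + (norm (g z))\<^sup>2)"
  proof (rule AE_I2)
    fix z
    have "0 \<le> (norm (f z) - norm (g z))\<^sup>2" by simp
    moreover have "0 \<le> norm (f z) * norm (g z)" by simp
    ultimately have "norm (f z) * norm (g z) \<le> (norm (f z))\<^sup>2 + (norm (g z))\<^sup>2"
      unfolding power2_diff by linarith
    then show "norm (f z * cnj (g z)) \<le> norm ((norm (f z))\<^sup>2 + (norm (g z))\<^sup>2)"
      by (simp add: norm_mult)
  qed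
qed

lemma L2_inner_add_left:
  "f \<in> A2 \<Longrightarrow> g \<in> A2 \<Longrightarrow> h \<in> A2 \<Longrightarrow> L2_inner (\<lambda>z. f z + g z) h = L2_inner f h + L2_inner g h"
  by (simp add: L2_inner_def A2_mult_cnj_integrable ring_distribs)

lemma L2_inner_cmult_left: "L2_inner (\<lambda>z. c * f z) h = c * L2_inner f h"
  by (simp add: L2_inner_def mult.assoc)

lemma L2_inner_cnj: "cnj (L2_inner f g) = L2_inner g f"
  unfolding L2_inner_def Bochner_Integration.integral_cnj[symmetric] by (simp add: mult.commute)

lemma Lp_int2_L2_inner: "of_real (Lp_int 2 f) = L2_inner f f"
  unfolding Lp_int2_eq L2_inner_def integral_complex_of_real[symmetric] complex_norm_square ..

lemma Lp_int2_add:
  assumes "f \<in> A2" "g \<in> A2"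
  shows "Lp_int 2 (\<lambda>z. f z + g z) = Lp_int 2 f + Lp_int 2 g + 2 * Re (L2_inner f g)"
proof -
  have "L2_inner (\<lambda>z. f z + g z) (\<lambda>z. f z + g z) = cnj (L2_inner (\<lambda>z. f z + g z) f) + cnj (L2_inner (\<lambda>z. f z + g z) g)"
    unfolding L2_inner_cnj using L2_inner_add_left[OF assms A2_add[OF assms]]
    by (metis (no_types, lifting) complex_cnj_add L2_inner_add_left A2_add assms L2_inner_cnj)
  also have "\<dots> = L2_inner f f + L2_inner f g + (L2_inner g f + L2_inner g g)"
    using assms by (simp add: L2_inner_add_left L2_inner_cnj)
  finally have "of_real (Lp_int 2 (\<lambda>z. f z + g z)) = L2_inner f f + L2_inner f g + (L2_inner g f + L2_inner g g)"
    by (simp add: Lp_int2_L2_inner)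
  then have "Lp_int 2 (\<lambda>z. f z + g z) = Re (L2_inner f f + L2_inner f g + (L2_inner g f + L2_inner g g))"
    by (metis Re_complex_of_real)
  moreover have "Re (L2_inner g f) = Re (L2_inner f g)" by (subst L2_inner_cnj[symmetric]) simp
  moreover have "Re (L2_inner f f) = Lp_int 2 f" "Re (L2_inner g g) = Lp_int 2 g"
    by (simp_all flip: Lp_int2_L2_inner)
  ultimately show ?thesis by simp
qed

lemma Lp_int2_cmult: "Lp_int 2 (\<lambda>z. c * f z) = (norm c)\<^sup>2 * Lp_int 2 f"
  by (simp add: Lp_int2_eq norm_mult power_mult_distrib)

text \<open>The parallelogram law, with the midpoint \<open>(f + g) / 2\<close> as a further competitor: near-minimal competitors
are close to each other.\<close>

lemma Lp_int2_diff_le: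
  assumes "f \<in> A2" "g \<in> A2" "f z = 1" "g z = 1"
  shows "Lp_int 2 (\<lambda>z. f z - g z) \<le> 2 * Lp_int 2 f + 2 * Lp_int 2 g - 4 * min_int 2 z"
proof -
  have g': "(\<lambda>z. - g z) \<in> A2" using A2_cmult[OF assms(2), of "-1"] by simp
  have *: "L2_inner f (\<lambda>z. - g z) = - L2_inner f g" by (simp add: L2_inner_def)
  have "min_int 2 z \<le> Lp_int 2 (\<lambda>z. (1/2) * (f z + g z))"
    using assms by (intro min_int_le A2_cmult A2_add) auto
  also have "\<dots> = (1/4) * (Lp_int 2 f + Lp_int 2 g + 2 * Re (L2_inner f g))"
    unfolding Lp_int2_cmult Lp_int2_add[OF assms(1,2)] by (simp add: power2_eq_square)
  finally show ?thesis
    using Lp_int2_add[OF assms(1) g'] Lp_int2_cmult[of "-1" g] * by simp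
qed

definition vol_cball :: "real \<Rightarrow> real" where "vol_cball r = measure lebesgue (cball (0 :: complex ^ 'n) r)"

lemma vol_cball_pos: "r > 0 \<Longrightarrow> vol_cball r > 0"
  unfolding vol_cball_def by (simp add: content_cball_pos)

lemma vol_cball_nonneg: "vol_cball r \<ge> 0"
  by (simp add: vol_cball_def)

lemma measure_cball: "measure lebesgue (cball (a :: complex ^ 'n) r) = vol_cball r"
  unfolding vol_cball_def by (cases "r < 0") (simp_all add: content_cball)

text \<open>The mean value property of the holomorphic function \<open>f\<^sup>2\<close> bounds \<open>\<bar>f a\<bar>\<^sup>2\<close> by the mean of \<open>\<bar>f\<bar>\<^sup>2\<close>. Convergence in
the mean thus implies locally uniform convergence.\<close>

lemma pointwise_le_Lp_int2:
  assumes f: "f \<in> A2" and r: "cball a r \<subseteq> \<Omega>" "r \<ge> 0"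
  shows "(norm (f a))\<^sup>2 * vol_cball r \<le> Lp_int 2 f"
proof -
  have hol: "f holomorphic_Cn_on \<Omega>" and int: "integrable (lebesgue_on \<Omega>) (\<lambda>z. (norm (f z))\<^sup>2)"
    using f by (auto simp: A2_iff)
  have B: "cball a r \<inter> space lebesgue \<in> sets lebesgue" by simp
  have intB: "integrable (lebesgue_on (cball a r)) (\<lambda>z. (norm (f z))\<^sup>2)"
    using int set_integrable_subset[of lebesgue \<Omega> "\<lambda>z. (norm (f z))\<^sup>2" "cball a r"] r(1)
    unfolding integrable_restrict_space[OF \<Omega>_sets] integrable_restrict_space[OF B] set_integrable_def by simp
  have "(norm (f a))\<^sup>2 * vol_cball r = norm (integral\<^sup>L (lebesgue_on (cball a r)) (\<lambda>z. (f z)\<^sup>2))"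
    using integral_cball_mean_value[OF holomorphic_Cn_power[OF hol, of 2] r]
    by (simp add: norm_mult norm_power measure_cball vol_cball_nonneg)
  also have "\<dots> \<le> integral\<^sup>L (lebesgue_on (cball a r)) (\<lambda>z. norm ((f z)\<^sup>2))"
    by (rule integral_norm_bound)
  also have "\<dots> = integral\<^sup>L (lebesgue_on (cball a r)) (\<lambda>z. (norm (f z))\<^sup>2)"
    by (simp add: norm_power)
  also have "\<dots> \<le> integral\<^sup>L (lebesgue_on \<Omega>) (\<lambda>z. (norm (f z))\<^sup>2)"
    unfolding integral_restrict_space[OF \<Omega>_sets] integral_restrict_space[OF B] set_lebesgue_integral_def
    using int intB r(1)
    by (intro integral_mono)
      (auto simp: integrable_restrict_space[OF \<Omega>_sets] integrable_restrict_space[OF B] set_integrable_def indicator_def)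
  finally show ?thesis by (simp add: Lp_int2_eq)
qed

lemma cball_subset_\<Omega>:
  assumes "z \<in> \<Omega>" obtains r where "r > 0" "cball z r \<subseteq> \<Omega>"
  using assms open_\<Omega> open_contains_cball by blast

lemma min_int2_pos: assumes "z \<in> \<Omega>" shows "min_int 2 z > 0"
proof -
  obtain r where r: "r > 0" "cball z r \<subseteq> \<Omega>" using cball_subset_\<Omega>[OF assms] by blast
  have "vol_cball r \<le> min_int 2 z"
  proof (rule ccontr)
    assume "\<not> vol_cball r \<le> min_int 2 z"
    then obtain f where "f \<in> A2" "f z = 1" "Lp_int 2 f < vol_cball r"
      using min_int_approx[of 2 z "vol_cball r"] by auto
    with pointwise_le_Lp_int2[of f z r] r show False by simp
  qed
  with vol_cball_pos[OF r(1)] show ?thesis by linarith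
qed

section \<open>The minimizer and the Bergman kernel for exponent two\<close>

lemma A2_minimizer_unique:
  assumes "f \<in> A2" "g \<in> A2" "f z = 1" "g z = 1" "Lp_int 2 f \<le> min_int 2 z" "Lp_int 2 g \<le> min_int 2 z" "\<zeta> \<in> \<Omega>"
  shows "f \<zeta> = g \<zeta>"
proof -
  obtain r where r: "r > 0" "cball \<zeta> r \<subseteq> \<Omega>" using cball_subset_\<Omega>[OF assms(7)] by blast
  have "(norm (f \<zeta> - g \<zeta>))\<^sup>2 * vol_cball r \<le> Lp_int 2 (\<lambda>z. f z - g z)"
    using pointwise_le_Lp_int2[OF A2_diff[OF assms(1,2)]] r by simp
  also have "\<dots> \<le> 0" using Lp_int2_diff_le[OF assms(1-4)] assms(5,6) by linarith
  finally have "norm (f \<zeta> - g \<zeta>) = 0"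
    using vol_cball_pos[OF r(1)] by (simp add: mult_le_0_iff)
  then show ?thesis by simp
qed

lemma minimizing_sequence_dist:
  assumes F: "\<And>n. F n \<in> A2" "\<And>n. F n z = 1" and lim: "(\<lambda>n. Lp_int 2 (F n)) \<longlonglongrightarrow> min_int 2 z"
    and r: "r > 0" and e: "e > 0"
  shows "\<exists>N. \<forall>m\<ge>N. \<forall>n\<ge>N. \<forall>x. cball x r \<subseteq> \<Omega> \<longrightarrow> norm (F m x - F n x) < e"
proof -
  have "e\<^sup>2 * vol_cball r / 4 > 0" using e vol_cball_pos[OF r] by simp
  then have "\<forall>\<^sub>F n in sequentially. Lp_int 2 (F n) < min_int 2 z + e\<^sup>2 * vol_cball r / 4"
    by (intro order_tendstoD(2)[OF lim]) simp
  then obtain N where N: "\<And>n. n \<ge> N \<Longrightarrow> Lp_int 2 (F n) < min_int 2 z + e\<^sup>2 * vol_cball r / 4"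
    unfolding eventually_sequentially by blast
  show ?thesis
  proof (intro exI[of _ N] allI impI)
    fix m n x assume *: "m \<ge> N" "n \<ge> N" "cball x r \<subseteq> \<Omega>"
    have "(norm (F m x - F n x))\<^sup>2 * vol_cball r \<le> Lp_int 2 (\<lambda>x. F m x - F n x)"
      using pointwise_le_Lp_int2[OF A2_diff[OF F(1) F(1)] *(3)] r by simp
    also have "\<dots> < e\<^sup>2 * vol_cball r"
      using Lp_int2_diff_le[OF F(1) F(1) F(2) F(2), of m n] N[OF *(1)] N[OF *(2)] by linarith
    finally have "(norm (F m x - F n x))\<^sup>2 < e\<^sup>2" using vol_cball_pos[OF r] by simp
    then show "norm (F m x - F n x) < e" using e by (simp add: power_less_imp_less_base)
  qed
qed

text \<open>A minimizing sequence is Cauchy in the mean, hence locally uniformly Cauchy. Its limit is holomorphic by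
Weierstrass, and by Fatou's lemma its integral does not exceed the minimum.\<close>

lemma minimizing_sequence_converges:
  assumes z: "z \<in> \<Omega>" and F: "\<And>n. F n \<in> A2" "\<And>n. F n z = 1" and lim: "(\<lambda>n. Lp_int 2 (F n)) \<longlonglongrightarrow> min_int 2 z"
  obtains g where "g \<in> A2" "g z = 1" "Lp_int 2 g = min_int 2 z" "\<And>x. x \<in> \<Omega> \<Longrightarrow> (\<lambda>n. F n x) \<longlonglongrightarrow> g x"
proof -
  have "\<exists>l. (\<lambda>n. F n x) \<longlonglongrightarrow> l" if x: "x \<in> \<Omega>" for x
  proof -
    obtain r where r: "r > 0" "cball x r \<subseteq> \<Omega>" using cball_subset_\<Omega>[OF x] by blast
    have "Cauchy (\<lambda>n. F n x)"
    proof (rule metric_CauchyI)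
      fix e :: real assume e: "e > 0"
      obtain N where N: "\<And>m n y. m \<ge> N \<Longrightarrow> n \<ge> N \<Longrightarrow> cball y r \<subseteq> \<Omega> \<Longrightarrow> norm (F m y - F n y) < e"
        using minimizing_sequence_dist[OF F lim r(1) e] by blast
      show "\<exists>N. \<forall>m\<ge>N. \<forall>n\<ge>N. dist (F m x) (F n x) < e"
        unfolding dist_norm using N[OF _ _ r(2)] by blast
    qed
    then show ?thesis using Cauchy_convergent convergent_def by blast
  qed
  then have "\<forall>x\<in>\<Omega>. \<exists>l. (\<lambda>n. F n x) \<longlonglongrightarrow> l" by blast
  from bchoice[OF this] obtain g where g: "\<And>x. x \<in> \<Omega> \<Longrightarrow> (\<lambda>n. F n x) \<longlonglongrightarrow> g x" by blast
  have hol: "F n holomorphic_Cn_on \<Omega>" for n using F(1) by (simp add: A2_iff)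
  have ghol: "g holomorphic_Cn_on \<Omega>"
  proof (rule holomorphic_Cn_uniform_limit[OF open_\<Omega> hol g])
    fix a assume "a \<in> \<Omega>"
    then obtain r where r: "r > 0" "cball a r \<subseteq> \<Omega>" using cball_subset_\<Omega> by blast
    have sub: "cball x (r/2) \<subseteq> \<Omega>" if "x \<in> ball a (r/2)" for x
    proof
      fix y assume "y \<in> cball x (r/2)"
      then have "dist a y \<le> r" using that dist_triangle[of a y x] by simp
      then show "y \<in> \<Omega>" using r(2) by auto
    qed
    have "uniformly_Cauchy_on (ball a (r/2)) F"
      unfolding uniformly_Cauchy_on_def
    proof (intro allI impI)
      fix e :: real assume e: "e > 0"
      have r2: "r/2 > 0" using r by simp
      obtain N where
        N: "\<And>m n x. m \<ge> N \<Longrightarrow> n \<ge> N \<Longrightarrow> cball x (r/2) \<subseteq> \<Omega> \<Longrightarrow> norm (F m x - F n x) < e"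
        using minimizing_sequence_dist[OF F lim r2 e] by blast
      show "\<exists>M. \<forall>x\<in>ball a (r/2). \<forall>m\<ge>M. \<forall>n\<ge>M. dist (F m x) (F n x) < e"
        unfolding dist_norm using N[OF _ _ sub] by blast
    qed
    moreover have "ball a (r/2) \<subseteq> \<Omega>" using r by (auto simp: subset_iff)
    ultimately show "\<exists>r>0. ball a r \<subseteq> \<Omega> \<and> uniformly_Cauchy_on (ball a r) F"
      using r(1) by (intro exI[of _ "r/2"]) simp
  qed
  have meas: "(\<lambda>x. ennreal ((norm (f x))\<^sup>2)) \<in> borel_measurable (lebesgue_on \<Omega>)"
    if "f holomorphic_Cn_on \<Omega>" for f
    using holomorphic_Cn_measurable[OF that open_\<Omega>] by measurable
  have IF: "(\<integral>\<^sup>+ x. ennreal ((norm (F n x))\<^sup>2) \<partial>lebesgue_on \<Omega>) = ennreal (Lp_int 2 (F n))" for n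
    using F(1)[of n] by (simp add: Lp_int2_eq A2_iff nn_integral_eq_integral)
  have "(\<integral>\<^sup>+ x. ennreal ((norm (g x))\<^sup>2) \<partial>lebesgue_on \<Omega>)
      = (\<integral>\<^sup>+ x. liminf (\<lambda>n. ennreal ((norm (F n x))\<^sup>2)) \<partial>lebesgue_on \<Omega>)"
  proof (rule nn_integral_cong)
    fix x assume "x \<in> space (lebesgue_on \<Omega>)"
    then have "x \<in> \<Omega>" by simp
    then have "(\<lambda>n. ennreal ((norm (F n x))\<^sup>2)) \<longlonglongrightarrow> ennreal ((norm (g x))\<^sup>2)"
      by (intro tendsto_ennrealI tendsto_intros g)
    then show "ennreal ((norm (g x))\<^sup>2) = liminf (\<lambda>n. ennreal ((norm (F n x))\<^sup>2))"
      by (metis lim_imp_Liminf sequentially_bot)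
  qed
  also have "\<dots> \<le> liminf (\<lambda>n. \<integral>\<^sup>+ x. ennreal ((norm (F n x))\<^sup>2) \<partial>lebesgue_on \<Omega>)"
    by (rule nn_integral_liminf) (rule meas[OF hol])
  also have "\<dots> = ennreal (min_int 2 z)"
    unfolding IF by (intro lim_imp_Liminf tendsto_ennrealI lim) simp
  finally have fatou: "(\<integral>\<^sup>+ x. ennreal ((norm (g x))\<^sup>2) \<partial>lebesgue_on \<Omega>) \<le> ennreal (min_int 2 z)" .
  have int: "integrable (lebesgue_on \<Omega>) (\<lambda>x. (norm (g x))\<^sup>2)"
  proof (rule integrableI_bounded)
    show "(\<lambda>x. (norm (g x))\<^sup>2) \<in> borel_measurable (lebesgue_on \<Omega>)"
      using holomorphic_Cn_measurable[OF ghol open_\<Omega>] by measurable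
    show "(\<integral>\<^sup>+ x. ennreal (norm ((norm (g x))\<^sup>2)) \<partial>lebesgue_on \<Omega>) < \<infinity>"
      using fatou by (simp add: order_le_less_trans)
  qed
  have gA: "g \<in> A2" using ghol int by (simp add: A2_iff)
  have gz: "g z = 1"
    using LIMSEQ_unique[OF g[OF z]] F(2) by simp
  have "ennreal (Lp_int 2 g) \<le> ennreal (min_int 2 z)"
    using fatou int by (simp add: Lp_int2_eq nn_integral_eq_integral)
  then have "Lp_int 2 g \<le> min_int 2 z" using min_int_nonneg by simp
  with min_int_le[OF _ gA gz] have "Lp_int 2 g = min_int 2 z" by simp
  with gA gz g that show ?thesis by blast
qed

lemma A2_minimizer_exists:
  assumes "z \<in> \<Omega>"
  obtains g where "g \<in> A2" "g z = 1" "Lp_int 2 g = min_int 2 z"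
proof -
  have "\<exists>f. f \<in> A2 \<and> f z = 1 \<and> Lp_int 2 f < min_int 2 z + 1 / real (Suc n)" for n
    using min_int_approx[of 2 z "min_int 2 z + 1 / real (Suc n)"] by force
  then obtain F where F: "\<And>n. F n \<in> A2" "\<And>n. F n z = 1" "\<And>n. Lp_int 2 (F n) < min_int 2 z + 1 / real (Suc n)"
    by metis
  have "(\<lambda>n. Lp_int 2 (F n)) \<longlonglongrightarrow> min_int 2 z"
  proof (rule tendsto_sandwich)
    show "\<forall>\<^sub>F n in sequentially. min_int 2 z \<le> Lp_int 2 (F n)"
      using F min_int_le by (intro always_eventually) auto
    show "\<forall>\<^sub>F n in sequentially. Lp_int 2 (F n) \<le> min_int 2 z + 1 / real (Suc n)"
      using F(3) by (intro always_eventually) (auto intro: less_imp_le)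
    show "(\<lambda>n. min_int 2 z + 1 / real (Suc n)) \<longlonglongrightarrow> min_int 2 z"
      using LIMSEQ_Suc[OF lim_inverse_n'] tendsto_add[OF tendsto_const, of "\<lambda>n. 1 / real (Suc n)" 0 sequentially "min_int 2 z"]
      by simp
  qed simp
  from minimizing_sequence_converges[OF assms F(1,2) this] that show ?thesis by metis
qed

text \<open>The minimizer \<open>m\<^sub>2(\<zeta>, z)\<close>, with the base point first, so that \<open>m z\<close> is the minimizing function.\<close>

definition m :: "complex ^ 'n \<Rightarrow> complex ^ 'n \<Rightarrow> complex" where "m z \<zeta> = m_off \<Omega> 2 \<zeta> z"

lemma m_eqI:
  assumes "z \<in> \<Omega>" "\<zeta> \<in> \<Omega>" "f \<in> A2" "f z = 1" "Lp_int 2 f \<le> min_int 2 z"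
  shows "m z \<zeta> = f \<zeta>"
  unfolding m_def
proof (rule m_off_eqI)
  show "Lp_int 2 f = min_int 2 z" using assms min_int_le[of 2 f z] by simp
qed (use assms A2_minimizer_unique in auto)

lemma m_props:
  assumes z: "z \<in> \<Omega>"
  shows m_A2: "m z \<in> A2" and m_self: "m z z = 1" and Lp_int2_m: "Lp_int 2 (m z) = min_int 2 z"
proof -
  obtain g where g: "g \<in> A2" "g z = 1" "Lp_int 2 g = min_int 2 z" using A2_minimizer_exists[OF z] by blast
  have eq: "m z \<zeta> = g \<zeta>" if "\<zeta> \<in> \<Omega>" for \<zeta>
    using m_eqI[OF z that g(1,2)] g(3) by simp
  show "m z \<in> A2" using bergman_space_cong[OF g(1)] eq by metis
  show "m z z = 1" using eq z g by simp
  show "Lp_int 2 (m z) = min_int 2 z" using Lp_int_cong[of "m z" g] eq g(3) by simp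
qed

lemma m_holomorphic: "z \<in> \<Omega> \<Longrightarrow> m z holomorphic_Cn_on \<Omega>"
  using m_A2 by (simp add: A2_iff)

lemma minimizing_sequence_tendsto_m:
  assumes z: "z \<in> \<Omega>" and F: "\<And>n. F n \<in> A2" "\<And>n. F n z = 1" and lim: "(\<lambda>n. Lp_int 2 (F n)) \<longlonglongrightarrow> min_int 2 z"
    and x: "x \<in> \<Omega>"
  shows "(\<lambda>n. F n x) \<longlonglongrightarrow> m z x"
proof -
  obtain g where g: "g \<in> A2" "g z = 1" "Lp_int 2 g = min_int 2 z" "(\<lambda>n. F n x) \<longlonglongrightarrow> g x"
    using minimizing_sequence_converges[OF z F lim] x by metis
  then show ?thesis using m_eqI[OF z x g(1,2)] by simp
qed

text \<open>Functions that vanish at \<open>z\<close> are the admissible variations of the minimizer, and a minimizer is orthogonal to them.\<close>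

lemma L2_inner_m_eq_0:
  assumes z: "z \<in> \<Omega>" and f: "f \<in> A2" "f z = 0"
  shows "L2_inner f (m z) = 0"
proof (rule ccontr)
  assume nz: "L2_inner f (m z) \<noteq> 0"
  define q where "q = (norm (L2_inner f (m z)))\<^sup>2"
  have q: "q > 0" using nz by (simp add: q_def)
  have *: "2 \<le> t * Lp_int 2 f" if t: "t > 0" for t
  proof -
    \<comment> \<open>The phase of \<open>c\<close> makes the first-order term of the variation \<open>m + c f\<close> as negative as possible.\<close>
    define c where "c = - of_real t * cnj (L2_inner f (m z))"
    have "min_int 2 z \<le> Lp_int 2 (\<lambda>x. c * f x + m z x)"
      using m_A2[OF z] m_self[OF z] f by (intro min_int_le A2_add A2_cmult) auto
    also have "\<dots> = (norm c)\<^sup>2 * Lp_int 2 f + min_int 2 z + 2 * Re (c * L2_inner f (m z))"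
      using Lp_int2_add[OF A2_cmult[OF f(1)] m_A2[OF z], of c] by (simp add: Lp_int2_cmult Lp_int2_m[OF z] L2_inner_cmult_left)
    also have "c * L2_inner f (m z) = - of_real (t * q)"
      unfolding q_def of_real_mult complex_norm_square by (simp add: c_def mult.commute)
    also have "(norm c)\<^sup>2 = t\<^sup>2 * q" by (simp add: c_def q_def norm_mult power_mult_distrib)
    finally have "2 * (t * q) \<le> t\<^sup>2 * q * Lp_int 2 f" by simp
    then have "(t * q) * 2 \<le> (t * q) * (t * Lp_int 2 f)" by (simp add: power2_eq_square algebra_simps)
    then show ?thesis using t q by simp
  qed
  have "2 \<le> (1 / (Lp_int 2 f + 1)) * Lp_int 2 f" using Lp_int_nonneg[of 2 f] by (intro *) simp
  then show False using Lp_int_nonneg[of 2 f] by (simp add: field_simps)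
qed

text \<open>The reproducing property of the kernel: \<open>f - f z * m z\<close> vanishes at \<open>z\<close>, so it is orthogonal to \<open>m z\<close>.\<close>

lemma L2_inner_m:
  assumes z: "z \<in> \<Omega>" and f: "f \<in> A2"
  shows "L2_inner f (m z) = f z * of_real (min_int 2 z)"
proof -
  have "L2_inner (\<lambda>x. f x + - f z * m z x) (m z) = 0"
    using assms m_A2[OF z] m_self[OF z] by (intro L2_inner_m_eq_0 A2_add A2_cmult) auto
  then have "L2_inner f (m z) = f z * L2_inner (m z) (m z)"
    using L2_inner_add_left[OF f A2_cmult[OF m_A2[OF z]] m_A2[OF z], of "- f z"] L2_inner_cmult_left[of "- f z" "m z" "m z"]
    by simp
  then show ?thesis by (simp add: Lp_int2_m[OF z] flip: Lp_int2_L2_inner)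
qed

lemma m_hermitian:
  assumes "z \<in> \<Omega>" "w \<in> \<Omega>"
  shows "m z w * of_real (min_int 2 w) = cnj (m w z) * of_real (min_int 2 z)"
  using L2_inner_m[OF assms(2) m_A2[OF assms(1)]] L2_inner_m[OF assms(1) m_A2[OF assms(2)]] L2_inner_cnj[of "m w" "m z"]
  by simp

text \<open>The Bergman kernel \<open>K\<^sub>2(\<zeta>, z)\<close>, see \<open>K_off_eq\<close>.\<close>

definition K :: "complex ^ 'n \<Rightarrow> complex ^ 'n \<Rightarrow> complex" where "K \<zeta> z = m z \<zeta> / of_real (min_int 2 z)"

lemma K_off_eq: "K_off \<Omega> 2 \<zeta> z = K \<zeta> z"
  by (simp add: K_off_def K_def K_diag_eq m_def divide_inverse)

text \<open>Hermitian symmetry makes \<open>K\<close> anti-holomorphic in its second argument; this is how zeros in the second argument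
are turned into zeros of holomorphic functions.\<close>

lemma K_cnj: "z \<in> \<Omega> \<Longrightarrow> w \<in> \<Omega> \<Longrightarrow> K w z = cnj (K z w)"
  using m_hermitian[of z w] min_int2_pos[of z] min_int2_pos[of w] by (simp add: K_def field_simps)

lemma K_self: "z \<in> \<Omega> \<Longrightarrow> K z z = of_real (inverse (min_int 2 z))"
  by (simp add: K_def m_self divide_inverse)

lemma K_holomorphic: "z \<in> \<Omega> \<Longrightarrow> (\<lambda>\<zeta>. K \<zeta> z) holomorphic_Cn_on \<Omega>"
  unfolding K_def divide_inverse
  by (intro holomorphic_Cn_mult holomorphic_Cn_const m_holomorphic)

end

section \<open>Circular symmetry of the kernel\<close>

text \<open>A complete Reinhardt domain is invariant under scaling all coordinates simultaneously by a complex number of modulus at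
most one. The relation between the values of the kernel along a line through the origin comes from this symmetry.\<close>

locale balanced_domain = bounded_open_set +
  assumes nonempty: "\<Omega> \<noteq> {}"
    and balanced: "z \<in> \<Omega> \<Longrightarrow> norm u \<le> 1 \<Longrightarrow> u *s z \<in> \<Omega>"
begin

lemma zero_in_\<Omega>: "0 \<in> \<Omega>"
  using nonempty balanced[of _ 0] by auto

lemma rotation_\<Omega>: assumes "norm u = 1" shows "u *s z \<in> \<Omega> \<longleftrightarrow> z \<in> \<Omega>"
proof
  have u: "cnj u * u = 1" using assms complex_norm_square[of u] by (simp add: mult.commute)
  assume "u *s z \<in> \<Omega>"
  from balanced[OF this, of "cnj u"] assms show "z \<in> \<Omega>" by (simp add: u)
qed (use assms balanced in auto)

lemma rotated_A2:
  assumes u: "norm u = 1" and f: "f \<in> A2"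
  shows "(\<lambda>z. f (u *s z)) \<in> A2" and "Lp_int 2 (\<lambda>z. f (u *s z)) = Lp_int 2 f"
proof -
  have uu: "cnj u * u = 1" "u * cnj u = 1" using u complex_norm_square[of u] by (simp_all add: mult.commute)
  have hol: "f holomorphic_Cn_on \<Omega>" and int: "integrable (lebesgue_on \<Omega>) (\<lambda>z. (norm (f z))\<^sup>2)"
    using f by (auto simp: A2_iff)
  have cont: "continuous_on \<Omega> (\<lambda>z. (norm (f z))\<^sup>2)"
    by (intro continuous_intros holomorphic_Cn_imp_continuous_on[OF hol])
  note rot = integral_isometry_lebesgue_on[of "\<lambda>z. u *s z" "\<lambda>z. cnj u *s z" \<Omega> "\<lambda>z. (norm (f z))\<^sup>2"]
  have "integrable (lebesgue_on \<Omega>) (\<lambda>z. (norm (f (u *s z)))\<^sup>2)"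
    by (subst rot(1)) (use u uu cont int open_\<Omega> rotation_\<Omega> in \<open>auto simp: dist_vector_scalar_mult\<close>)
  then show "(\<lambda>z. f (u *s z)) \<in> A2"
    using u balanced by (auto simp: A2_iff intro!: holomorphic_Cn_scaled[OF hol])
  show "Lp_int 2 (\<lambda>z. f (u *s z)) = Lp_int 2 f"
    unfolding Lp_int2_eq
    by (subst rot(2)) (use u uu cont int open_\<Omega> rotation_\<Omega> in \<open>auto simp: dist_vector_scalar_mult\<close>)
qed

lemma min_int2_rotation_le:
  assumes u: "norm u = 1" and z: "z \<in> \<Omega>" shows "min_int 2 z \<le> min_int 2 (u *s z)"
proof -
  have uz: "u *s z \<in> \<Omega>" using u z by (simp add: rotation_\<Omega>)
  have "min_int 2 z \<le> Lp_int 2 (\<lambda>x. m (u *s z) (u *s x))"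
    using rotated_A2(1)[OF u m_A2[OF uz]] m_self[OF uz] by (intro min_int_le) auto
  then show ?thesis using rotated_A2(2)[OF u m_A2[OF uz]] Lp_int2_m[OF uz] by simp
qed

lemma min_int2_rotation:
  assumes u: "norm u = 1" and z: "z \<in> \<Omega>" shows "min_int 2 (u *s z) = min_int 2 z"
proof -
  have uu: "cnj u * u = 1" using u complex_norm_square[of u] by (simp add: mult.commute)
  have "min_int 2 (u *s z) \<le> min_int 2 (cnj u *s (u *s z))"
    using u z by (intro min_int2_rotation_le) (auto simp: rotation_\<Omega>)
  also have "cnj u *s (u *s z) = z" by (simp add: uu)
  finally show ?thesis using min_int2_rotation_le[OF u z] by simp
qed

text \<open>A rotation \<open>\<zeta> \<mapsto> u \<zeta>\<close> preserves the competitors and their integrals, so it maps minimizers to minimizers.\<close>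

lemma K_rotation:
  assumes u: "norm u = 1" and z: "z \<in> \<Omega>" "\<zeta> \<in> \<Omega>"
  shows "K (u *s \<zeta>) (u *s z) = K \<zeta> z"
proof -
  have uz: "u *s z \<in> \<Omega>" using u z by (simp add: rotation_\<Omega>)
  have "m z \<zeta> = m (u *s z) (u *s \<zeta>)"
    using rotated_A2[OF u m_A2[OF uz]] m_self[OF uz] min_int2_rotation[OF u z(1)] Lp_int2_m[OF uz]
    by (intro m_eqI[OF z]) auto
  then show ?thesis using min_int2_rotation[OF u z(1)] by (simp add: K_def)
qed

text \<open>Both sides are holomorphic in \<open>t\<close> on the unit disc; the conjugations cancel on the right because \<open>K\<close> is
anti-holomorphic in the second argument. On the unit circle they agree by \<open>K_rotation\<close>, hence on the disc by the
maximum principle.\<close>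

lemma K_dilation:
  assumes z: "z \<in> \<Omega>" "\<zeta> \<in> \<Omega>" and t: "norm t \<le> 1"
  shows "K (t *s \<zeta>) z = K \<zeta> (cnj t *s z)"
proof -
  define H where "H s = K (s *s \<zeta>) z" for s
  define G where "G s = K (s *s z) \<zeta>" for s
  have H: "H holomorphic_on cball 0 1"
    unfolding H_def using holomorphic_on_complex_line[OF K_holomorphic[OF z(1)], of "cball 0 1" 0 \<zeta>] balanced z
    by auto
  have G: "G holomorphic_on cball 0 1"
    unfolding G_def using holomorphic_on_complex_line[OF K_holomorphic[OF z(2)], of "cball 0 1" 0 z] balanced z
    by auto
  have cnj_ball: "cnj ` ball 0 1 \<subseteq> cball 0 1" by auto
  have G': "cnj \<circ> G \<circ> cnj holomorphic_on ball 0 1"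
    by (rule holomorphic_on_compose_cnj_cnj) (use G cnj_ball holomorphic_on_subset in auto)
  have contG: "continuous_on (cball 0 1) (\<lambda>s. cnj (G (cnj s)))"
    by (intro continuous_on_cnj continuous_on_compose2[OF holomorphic_on_imp_continuous_on[OF G]] continuous_intros) auto
  have cnjG: "cnj (G (cnj s)) = K \<zeta> (cnj s *s z)" if "norm s \<le> 1" for s
    unfolding G_def using balanced[OF z(1), of "cnj s"] that z K_cnj[of "cnj s *s z" \<zeta>] by simp
  have "norm (H t - cnj (G (cnj t))) \<le> 0"
  proof (rule maximum_modulus_frontier[of "\<lambda>s. H s - cnj (G (cnj s))" "cball 0 1"])
    show "(\<lambda>s. H s - cnj (G (cnj s))) holomorphic_on interior (cball 0 1)"
      using G' H by (auto intro!: holomorphic_intros simp: o_def intro: holomorphic_on_subset)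
    show "continuous_on (closure (cball 0 1)) (\<lambda>s. H s - cnj (G (cnj s)))"
      using contG holomorphic_on_imp_continuous_on[OF H] by (simp add: continuous_on_diff)
    show "norm (H s - cnj (G (cnj s))) \<le> 0" if "s \<in> frontier (cball 0 1)" for s
    proof -
      have s: "norm s = 1" using that by (simp add: frontier_cball)
      have ss: "s * cnj s = 1" using s complex_norm_square[of s] by simp
      have "K (s *s \<zeta>) (s *s (cnj s *s z)) = K \<zeta> (cnj s *s z)"
        by (rule K_rotation) (use s z in \<open>auto simp: rotation_\<Omega>\<close>)
      moreover have "s *s (cnj s *s z) = z" by (simp add: ss)
      ultimately show ?thesis using s by (simp only: cnjG H_def) simp
    qed
  qed (use t in auto)
  then show ?thesis using cnjG[OF t] by (simp add: H_def)
qed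

lemma real_scale_\<Omega>: "z \<in> \<Omega> \<Longrightarrow> 0 \<le> t \<Longrightarrow> t \<le> 1 \<Longrightarrow> of_real t *s z \<in> \<Omega>"
  using balanced[of z "of_real t"] by simp

lemma K_real_dilation:
  assumes "z \<in> \<Omega>" "\<zeta> \<in> \<Omega>" "0 \<le> t" "t \<le> 1"
  shows "K \<zeta> (of_real t *s z) = K (of_real t *s \<zeta>) z"
  using K_dilation[of z \<zeta> "of_real t"] assms by simp

lemma K_zero: "z \<in> \<Omega> \<Longrightarrow> K 0 z = of_real (inverse (min_int 2 0))"
  using K_dilation[of z 0 0] zero_in_\<Omega> by (simp add: K_self)

text \<open>Along a real segment from the origin the diagonal value \<open>K(t z, t z)\<close> is thus given by a function that is
holomorphic in \<open>t\<close>, so it continues analytically in \<open>t\<close>.\<close>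

lemma min_int2_real_dilation:
  assumes "z \<in> \<Omega>" "0 \<le> t" "t \<le> 1"
  shows "of_real (inverse (min_int 2 (of_real t *s z))) = K (of_real (t\<^sup>2) *s z) z"
  using K_self[OF real_scale_\<Omega>[OF assms]] K_real_dilation[OF assms(1) real_scale_\<Omega>[OF assms] assms(2,3)]
  by (simp add: power2_eq_square)

text \<open>\<open>K \<zeta> (t z) = K (t \<zeta>) z\<close> only involves values of \<open>K \<cdot> z\<close> near the origin when \<open>t\<close> is small, uniformly for \<open>\<zeta>\<close> in
the bounded set \<open>\<Omega>\<close>, and \<open>K 0 z\<close> is positive.\<close>

lemma Re_m_pos_near_zero:
  assumes z: "z \<in> \<Omega>"
  obtains \<delta> where "0 < \<delta>" "\<delta> \<le> 1"
    "\<And>t \<zeta>. 0 \<le> t \<Longrightarrow> t \<le> \<delta> \<Longrightarrow> \<zeta> \<in> \<Omega> \<Longrightarrow> Re (m (of_real t *s z) \<zeta>) > 0"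
proof -
  have "continuous_on \<Omega> (\<lambda>\<zeta>. K \<zeta> z)"
    by (rule holomorphic_Cn_imp_continuous_on[OF K_holomorphic[OF z]])
  then have "isCont (\<lambda>\<zeta>. Re (K \<zeta> z)) 0"
    using open_\<Omega> zero_in_\<Omega> by (auto simp: continuous_on_eq_continuous_at intro: isCont_Re)
  moreover have "Re (K 0 z) > 0" using K_zero[OF z] min_int2_pos[OF zero_in_\<Omega>] by simp
  ultimately have "\<forall>\<^sub>F x in at 0. Re (K x z) > 0"
    by (simp add: continuous_at order_tendstoD(1))
  then obtain e where e: "e > 0" "\<And>x. norm x < e \<Longrightarrow> x \<noteq> 0 \<Longrightarrow> Re (K x z) > 0"
    unfolding eventually_at by (auto simp: dist_norm)
  have e': "Re (K x z) > 0" if "norm x < e" for x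
    using e(2)[OF that] \<open>Re (K 0 z) > 0\<close> by (cases "x = 0") auto
  obtain R where R: "R > 0" "\<And>x. x \<in> \<Omega> \<Longrightarrow> norm x \<le> R"
    using bounded_\<Omega> bounded_pos by blast
  show ?thesis
  proof (rule that[of "min 1 (e / (2 * R))"])
    fix t \<zeta> assume t: "0 \<le> t" "t \<le> min 1 (e / (2 * R))" and \<zeta>: "\<zeta> \<in> \<Omega>"
    have tz: "of_real t *s z \<in> \<Omega>" using t z by (intro real_scale_\<Omega>) auto
    have "norm (of_real t *s \<zeta>) \<le> e / (2 * R) * R"
      unfolding norm_vector_scalar_mult using t R(2)[OF \<zeta>] e(1) R(1) by (intro mult_mono) auto
    also have "\<dots> < e" using e(1) R(1) by simp
    finally have "Re (K (of_real t *s \<zeta>) z) > 0" by (rule e')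
    then have "Re (K \<zeta> (of_real t *s z)) > 0"
      using K_real_dilation[OF z \<zeta>, of t] t by simp
    then show "Re (m (of_real t *s z) \<zeta>) > 0"
      using min_int2_pos[OF tz] by (simp add: K_def zero_less_divide_iff)
  qed (use e R in auto)
qed

section \<open>Minimizers for exponents above two\<close>

text \<open>The exponents are chosen such that \<open>\<bar>h\<bar>\<^sup>2 = (\<bar>m\<bar>\<^sup>2) ^ (1 - 2 / p) * (\<bar>g\<bar>\<^sup>p) ^ (2 / p)\<close>, to which Young's inequality
applies with weights \<open>1 - 2 / p\<close> and \<open>2 / p\<close>.\<close>

lemma A2_twisted_le:
  assumes w: "w \<in> \<Omega>" and pos: "\<And>\<zeta>. \<zeta> \<in> \<Omega> \<Longrightarrow> Re (m w \<zeta>) > 0" and p: "p > 2"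
    and g: "g \<in> bergman_space \<Omega> p"
  defines "h \<equiv> (\<lambda>\<zeta>. m w \<zeta> powr of_real (1 - 2 / p) * g \<zeta>)"
  shows "h \<in> A2" and "Lp_int 2 h \<le> (1 - 2 / p) * min_int 2 w + (2 / p) * Lp_int p g"
proof -
  let ?q = "\<lambda>\<zeta>. (1 - 2 / p) * (norm (m w \<zeta>))\<^sup>2 + (2 / p) * norm (g \<zeta>) powr p"
  have ghol: "g holomorphic_Cn_on \<Omega>" and gint: "integrable (lebesgue_on \<Omega>) (\<lambda>z. norm (g z) powr p)"
    using g by (auto simp: bergman_space_iff)
  have mint: "integrable (lebesgue_on \<Omega>) (\<lambda>z. (norm (m w z))\<^sup>2)"
    using m_A2[OF w] by (simp add: A2_iff)
  have bound: "norm (h \<zeta>) powr 2 \<le> ?q \<zeta>" if "\<zeta> \<in> \<Omega>" for \<zeta>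
  proof (cases "g \<zeta> = 0")
    case False
    have mn0: "m w \<zeta> \<noteq> 0" using pos[OF that] by auto
    have "norm (h \<zeta>) powr 2 = ((norm (m w \<zeta>))\<^sup>2) powr (1 - 2 / p) * (norm (g \<zeta>) powr p) powr (2 / p)"
      using p mn0 by (simp add: h_def norm_mult norm_powr_real_powr' powr_mult powr_powr field_simps
          flip: powr_numeral)
    also have "\<dots> \<le> ?q \<zeta>"
      using p mn0 False by (intro Youngs_inequality_0) auto
    finally show ?thesis .
  qed (use p in \<open>simp add: h_def\<close>)
  have hol: "h holomorphic_Cn_on \<Omega>"
    unfolding h_def
  proof (intro holomorphic_Cn_mult ghol)
    show "(\<lambda>\<zeta>. m w \<zeta> powr of_real (1 - 2 / p)) holomorphic_Cn_on \<Omega>"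
      by (rule holomorphic_Cn_compose[OF m_holomorphic[OF w], where S="{z. Re z > 0}"])
        (use pos in \<open>auto intro!: holomorphic_intros open_halfspace_Re_gt simp: complex_nonpos_Reals_iff\<close>)
  qed
  show h: "h \<in> A2"
    by (rule bergman_space_bound[OF hol _ bound]) (use mint gint in auto)
  have "Lp_int 2 h \<le> integral\<^sup>L (lebesgue_on \<Omega>) ?q"
    unfolding Lp_int_def by (rule integral_mono) (use h bound mint gint in \<open>auto simp: bergman_space_iff\<close>)
  also have "\<dots> = (1 - 2 / p) * Lp_int 2 (m w) + (2 / p) * Lp_int p g"
    using mint gint by (simp add: Lp_int_def)
  finally show "Lp_int 2 h \<le> (1 - 2 / p) * min_int 2 w + (2 / p) * Lp_int p g"
    by (simp add: Lp_int2_m[OF w])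
qed

text \<open>Positivity of the real part makes the principal power a holomorphic function. Since \<open>h = m ^ (1 - 2 / p) * g\<close>
is a competitor for the exponent two, \<open>A2_twisted_le\<close> gives \<open>M \<le> (1 - 2 / p) * M + (2 / p) * \<parallel>g\<parallel>\<^sub>p\<^sup>p\<close> for the minimum
\<open>M\<close>, and in the case of equality \<open>h\<close> is the unique minimizer, which determines \<open>g\<close>.\<close>

lemma minimizer_of_Re_pos:
  assumes w: "w \<in> \<Omega>" and pos: "\<And>\<zeta>. \<zeta> \<in> \<Omega> \<Longrightarrow> Re (m w \<zeta>) > 0" and p: "p > 2"
  shows "min_int p w = min_int 2 w" and "\<And>\<zeta>. \<zeta> \<in> \<Omega> \<Longrightarrow> m_off \<Omega> p \<zeta> w = m w \<zeta> powr of_real (2 / p)"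
proof -
  define f where "f \<zeta> = m w \<zeta> powr of_real (2 / p)" for \<zeta>
  have fp: "norm (f \<zeta>) powr p = (norm (m w \<zeta>))\<^sup>2" for \<zeta>
    using p by (simp add: f_def norm_powr_real_powr' powr_powr)
  have hol: "f holomorphic_Cn_on \<Omega>"
    unfolding f_def
    by (rule holomorphic_Cn_compose[OF m_holomorphic[OF w], where S="{z. Re z > 0}"])
      (use pos in \<open>auto intro!: holomorphic_intros open_halfspace_Re_gt simp: complex_nonpos_Reals_iff\<close>)
  have f: "f \<in> bergman_space \<Omega> p"
    using m_A2[OF w] hol by (simp add: bergman_space_iff fp)
  have fw: "f w = 1" by (simp add: f_def m_self[OF w])
  have If: "Lp_int p f = min_int 2 w" using Lp_int2_m[OF w] by (simp add: Lp_int_def fp)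
  let ?h = "\<lambda>g \<zeta>. m w \<zeta> powr of_real (1 - 2 / p) * g \<zeta>"
  have hw: "?h g w = 1" if "g w = 1" for g using that by (simp add: m_self[OF w])
  have "min_int 2 w \<le> Lp_int p g" if g: "g \<in> bergman_space \<Omega> p" "g w = 1" for g
  proof -
    have "min_int 2 w \<le> Lp_int 2 (?h g)"
      using A2_twisted_le(1)[OF w pos p g(1)] hw g by (intro min_int_le) auto
    also have "\<dots> \<le> (1 - 2 / p) * min_int 2 w + (2 / p) * Lp_int p g"
      by (rule A2_twisted_le(2)[OF w pos p g(1)])
    finally have "(2 / p) * min_int 2 w \<le> (2 / p) * Lp_int p g" by (simp add: algebra_simps)
    then show ?thesis using p by (simp add: divide_right_mono field_simps)
  qed
  then show Mp: "min_int p w = min_int 2 w"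
    using min_int_eqI[OF _ f fw] p If by simp
  fix \<zeta> assume \<zeta>: "\<zeta> \<in> \<Omega>"
  have "m_off \<Omega> p \<zeta> w = f \<zeta>"
  proof (rule m_off_eqI[OF _ f fw _ _ w \<zeta>])
    fix g x assume g: "g \<in> bergman_space \<Omega> p" "g w = 1" "Lp_int p g = min_int p w" and x: "x \<in> \<Omega>"
    have "Lp_int 2 (?h g) \<le> (1 - 2 / p) * min_int 2 w + (2 / p) * Lp_int p g"
      by (rule A2_twisted_le(2)[OF w pos p g(1)])
    also have "\<dots> = min_int 2 w" by (simp add: g(3) Mp algebra_simps)
    finally have "m w x = ?h g x"
      using A2_twisted_le(1)[OF w pos p g(1)] hw g by (intro m_eqI[OF w x]) auto
    moreover have "m w x = m w x powr of_real (1 - 2 / p) * f x"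
      using pos[OF x] by (auto simp: f_def simp flip: powr_add)
    ultimately have "m w x powr of_real (1 - 2 / p) * g x = m w x powr of_real (1 - 2 / p) * f x"
      by (rule trans[OF sym])
    then show "g x = f x" using pos[OF x] by auto
  qed (use p If Mp in auto)
  then show "m_off \<Omega> p \<zeta> w = m w \<zeta> powr of_real (2 / p)" by (simp add: f_def)
qed

end

section \<open>Analytic continuation along real segments\<close>

text \<open>Real analyticity of a function of one real variable at a point, expressed by a holomorphic extension instead of
by power series, so that closure under algebraic operations is immediate.\<close>

definition extends_holomorphically_at :: "(real \<Rightarrow> complex) \<Rightarrow> real \<Rightarrow> bool"
  where "extends_holomorphically_at \<phi> t \<longleftrightarrow>
    (\<exists>\<rho>>0. \<exists>F. F holomorphic_on ball (of_real t) \<rho> \<and> (\<forall>s. \<bar>s - t\<bar> < \<rho> \<longrightarrow> F (of_real s) = \<phi> s))"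

lemma extends_holomorphically_atI:
  assumes "open S" "of_real t \<in> S" "F holomorphic_on S" "\<And>s. of_real s \<in> S \<Longrightarrow> F (of_real s) = \<phi> s"
  shows "extends_holomorphically_at \<phi> t"
proof -
  obtain e where e: "e > 0" "ball (of_real t) e \<subseteq> S" using assms(1,2) open_contains_ball by blast
  have "of_real s \<in> ball (of_real t :: complex) e" if "\<bar>s - t\<bar> < e" for s
    using that by (simp add: dist_norm norm_minus_commute flip: of_real_diff)
  then show ?thesis
    unfolding extends_holomorphically_at_def
    using e assms(3,4) by (meson holomorphic_on_subset subsetD)
qed

lemma extends_holomorphically_at_combine:
  assumes "extends_holomorphically_at \<phi> t" "extends_holomorphically_at \<psi> t"
    and op: "\<And>F G S. F holomorphic_on S \<Longrightarrow> G holomorphic_on S \<Longrightarrow> (\<lambda>z. op (F z) (G z)) holomorphic_on S"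
  shows "extends_holomorphically_at (\<lambda>s. op (\<phi> s) (\<psi> s)) t"
proof -
  obtain r F where F: "r > 0" "F holomorphic_on ball (of_real t) r" "\<And>s. \<bar>s - t\<bar> < r \<Longrightarrow> F (of_real s) = \<phi> s"
    using assms(1) unfolding extends_holomorphically_at_def by blast
  obtain q G where G: "q > 0" "G holomorphic_on ball (of_real t) q" "\<And>s. \<bar>s - t\<bar> < q \<Longrightarrow> G (of_real s) = \<psi> s"
    using assms(2) unfolding extends_holomorphically_at_def by blast
  show ?thesis
    unfolding extends_holomorphically_at_def
  proof (intro exI[of _ "min r q"] exI[of _ "\<lambda>z. op (F z) (G z)"] conjI allI impI)
    show "(\<lambda>z. op (F z) (G z)) holomorphic_on ball (of_real t) (min r q)"
      by (rule op) (use F(2) G(2) in \<open>auto elim!: holomorphic_on_subset\<close>)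
  qed (use F G in auto)
qed

lemma extends_holomorphically_at_mult:
  "extends_holomorphically_at \<phi> t \<Longrightarrow> extends_holomorphically_at \<psi> t \<Longrightarrow>
    extends_holomorphically_at (\<lambda>s. \<phi> s * \<psi> s) t"
  by (rule extends_holomorphically_at_combine) (auto intro: holomorphic_intros)

lemma extends_holomorphically_at_diff:
  "extends_holomorphically_at \<phi> t \<Longrightarrow> extends_holomorphically_at \<psi> t \<Longrightarrow>
    extends_holomorphically_at (\<lambda>s. \<phi> s - \<psi> s) t"
  by (rule extends_holomorphically_at_combine) (auto intro: holomorphic_intros)

lemma extends_holomorphically_at_power:
  "extends_holomorphically_at \<phi> t \<Longrightarrow> extends_holomorphically_at (\<lambda>s. \<phi> s ^ n) t"
  using extends_holomorphically_at_combine[of \<phi> t \<phi> "\<lambda>x y. x ^ n"] by (auto intro: holomorphic_intros)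

text \<open>At the supremum \<open>c\<close> of the parameters up to which \<open>\<phi>\<close> vanishes, the holomorphic extension has zeros
accumulating at \<open>c\<close>, so it vanishes in a neighbourhood of \<open>c\<close>.\<close>

lemma extends_holomorphically_at_zero_propagates:
  assumes ext: "\<And>t. t \<in> {0..1} \<Longrightarrow> extends_holomorphically_at \<phi> t"
    and zero: "\<And>t. 0 < t \<Longrightarrow> t < \<delta> \<Longrightarrow> \<phi> t = 0" and "0 < \<delta>" "\<delta> \<le> 1"
  shows "\<phi> 1 = 0"
proof -
  define T where "T = {t \<in> {0..1}. \<forall>s. 0 < s \<longrightarrow> s < t \<longrightarrow> \<phi> s = 0}"
  define c where "c = Sup T"
  have \<delta>T: "\<delta> \<in> T" using assms(3,4) zero by (auto simp: T_def)
  have bdd: "bdd_above T" by (auto simp: T_def intro!: bdd_aboveI[of _ 1])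
  have c: "\<delta> \<le> c" "c \<le> 1"
    unfolding c_def
    by (rule cSup_upper[OF \<delta>T bdd], rule cSup_least) (use \<delta>T in \<open>auto simp: T_def\<close>)
  have below: "\<phi> s = 0" if s: "0 < s" "s < c" for s
  proof -
    obtain t where "t \<in> T" "s < t" using less_cSupD[of T s] s(2) \<delta>T unfolding c_def by blast
    then show ?thesis using s(1) unfolding T_def by blast
  qed
  obtain r F where F: "r > 0" "F holomorphic_on ball (of_real c) r" "\<And>s. \<bar>s - c\<bar> < r \<Longrightarrow> F (of_real s) = \<phi> s"
    using ext[of c] c assms(3) unfolding extends_holomorphically_at_def by auto
  define q where "q = min r c"
  have q: "q > 0" "q \<le> r" "q \<le> c" using F(1) c assms(3) by (auto simp: q_def)
  define U where "U = of_real ` {c - q<..<c} \<inter> ball (of_real c :: complex) r"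
  have "of_real c islimpt U"
    unfolding islimpt_approachable
  proof (intro allI impI)
    fix e :: real assume e: "e > 0"
    define s where "s = c - min q e / 2"
    have s: "c - q < s" "s < c" "c - s < e" "c - s < r" using e q by (auto simp: s_def min_def)
    then have d: "dist (of_real s :: complex) (of_real c) < e" "dist (of_real c :: complex) (of_real s) < r"
      by (simp_all add: dist_norm flip: of_real_diff)
    have "of_real s \<in> U" using s d by (auto simp: U_def)
    then show "\<exists>x'\<in>U. x' \<noteq> of_real c \<and> dist x' (of_real c) < e"
      using d s by (intro bexI[of _ "of_real s"]) auto
  qed
  then have F0: "F w = 0" if "w \<in> ball (of_real c) r" for w
  proof (intro analytic_continuation[OF F(2) _ _ _ _ \<open>of_real c islimpt U\<close> _ that])
    show "F z = 0" if z: "z \<in> U" for z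
    proof -
      obtain s where s: "z = of_real s" "c - q < s" "s < c" using z by (auto simp: U_def)
      then have "F z = \<phi> s" using F(3)[of s] q by auto
      also have "\<dots> = 0" using s q by (intro below) auto
      finally show ?thesis .
    qed
  qed (use F(1) in \<open>auto simp: U_def\<close>)
  have \<phi>0: "\<phi> s = 0" if "\<bar>s - c\<bar> < r" for s
  proof -
    have "of_real s \<in> ball (of_real c :: complex) r"
      using that by (simp add: dist_norm norm_minus_commute flip: of_real_diff)
    then show ?thesis using F0 F(3)[OF that] by metis
  qed
  have "c = 1"
  proof (rule ccontr)
    assume "c \<noteq> 1"
    define t where "t = min 1 (c + r / 2)"
    have t: "c < t" "t \<le> 1" "t < c + r" using \<open>c \<noteq> 1\<close> c F(1) by (auto simp: t_def)
    have "\<phi> s = 0" if "0 < s" "s < t" for s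
      using below[of s] \<phi>0[of s] that t by (cases "s < c") auto
    then have "t \<in> T" using t c assms(3) by (auto simp: T_def)
    then have "t \<le> c" unfolding c_def by (rule cSup_upper[OF _ bdd])
    with t show False by simp
  qed
  then show ?thesis using \<phi>0[of 1] F(1) by simp
qed

text \<open>Substituting \<open>a + s v\<close> into the power series in several variables and collecting the terms of equal total degree
gives a power series in \<open>s\<close> with real coefficients. It converges for complex arguments as well.\<close>

lemma real_analytic_on_line:
  fixes f :: "'a::euclidean_space \<Rightarrow> real"
  assumes f: "f real_analytic_on S" and a: "a + t *\<^sub>R v \<in> S"
  shows "extends_holomorphically_at (\<lambda>s. of_real (f (a + s *\<^sub>R v))) t"
proof -
  define b where "b = a + t *\<^sub>R v"
  define X where "X = {\<alpha> :: 'a \<Rightarrow> nat. \<forall>b. b \<notin> Basis \<longrightarrow> \<alpha> b = 0}"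
  obtain r c where r: "r > 0" and c: "\<And>x. x \<in> ball b r \<Longrightarrow>
      ((\<lambda>\<alpha>. c \<alpha> * (\<Prod>i\<in>Basis. ((x - b) \<bullet> i) ^ \<alpha> i)) has_sum f x) X"
    using f a unfolding real_analytic_def b_def X_def by blast
  define \<rho> where "\<rho> = r / (norm v + 1)"
  have v1: "norm v + 1 > 0" by (simp add: add_nonneg_pos)
  have \<rho>: "\<rho> > 0" using r v1 by (simp add: \<rho>_def)
  have in_ball: "b + s *\<^sub>R v \<in> ball b r" if "\<bar>s\<bar> < \<rho>" for s
  proof -
    have "\<bar>s\<bar> * norm v \<le> \<bar>s\<bar> * (norm v + 1)" by (simp add: mult_left_mono)
    also have "\<dots> < r" using that v1 by (simp add: \<rho>_def field_simps)
    finally show ?thesis by (simp add: dist_norm)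
  qed
  define N where "N \<alpha> = (\<Sum>i\<in>Basis. \<alpha> i)" for \<alpha> :: "'a \<Rightarrow> nat"
  define w where "w \<alpha> = c \<alpha> * (\<Prod>i\<in>Basis. (v \<bullet> i) ^ \<alpha> i)" for \<alpha>
  have hs: "((\<lambda>\<alpha>. w \<alpha> * s ^ N \<alpha>) has_sum f (b + s *\<^sub>R v)) X" if "\<bar>s\<bar> < \<rho>" for s
  proof -
    have "c \<alpha> * (\<Prod>i\<in>Basis. ((b + s *\<^sub>R v - b) \<bullet> i) ^ \<alpha> i) = w \<alpha> * s ^ N \<alpha>" for \<alpha>
      by (simp add: w_def N_def power_mult_distrib prod.distrib power_sum mult_ac)
    then show ?thesis using c[OF in_ball[OF that]] by simp
  qed
  define B where "B n = {\<alpha> \<in> X. N \<alpha> = n}" for n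
  define d where "d n = infsum w (B n)" for n
  \<comment> \<open>The coefficients are summed at the nonzero parameter \<open>\<rho> / 2\<close>, where the common factor can be cancelled;
    this also covers the parameter \<open>0\<close>.\<close>
  have dn: "(w has_sum d n) (B n)" for n
  proof -
    have "(\<lambda>\<alpha>. w \<alpha> * (\<rho>/2) ^ N \<alpha>) summable_on X"
      using hs[of "\<rho>/2"] \<rho> by (auto simp: summable_on_def)
    then have "(\<lambda>\<alpha>. w \<alpha> * (\<rho>/2) ^ N \<alpha>) summable_on B n"
      by (rule summable_on_subset) (auto simp: B_def)
    then have "(\<lambda>\<alpha>. w \<alpha> * (\<rho>/2) ^ n) summable_on B n"
      by (rule summable_on_cong[THEN iffD1, rotated]) (auto simp: B_def)
    then have "(\<lambda>\<alpha>. w \<alpha> * (\<rho>/2) ^ n * inverse ((\<rho>/2) ^ n)) summable_on B n"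
      by (rule summable_on_cmult_left)
    then have "w summable_on B n" using \<rho> by (simp add: mult.assoc)
    then show ?thesis unfolding d_def by (rule has_sum_infsum)
  qed
  have sums: "(\<lambda>n. d n * s ^ n) sums f (b + s *\<^sub>R v)" if "\<bar>s\<bar> < \<rho>" for s
  proof (rule has_sum_imp_sums, rule has_sum_SigmaD)
    show "((\<lambda>(n, \<alpha>). w \<alpha> * s ^ n) has_sum f (b + s *\<^sub>R v)) (Sigma UNIV B)"
      using hs[OF that]
      by (subst has_sum_reindex_bij_witness[where T=X and j=snd and i="\<lambda>\<alpha>. (N \<alpha>, \<alpha>)"
            and h="\<lambda>\<alpha>. w \<alpha> * s ^ N \<alpha>", OF _ _ _ _ _ refl])
        (auto simp: B_def)
    show "((\<lambda>\<alpha>. case (n, \<alpha>) of (n, \<alpha>) \<Rightarrow> w \<alpha> * s ^ n) has_sum d n * s ^ n) (B n)" for n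
      using has_sum_cmult_left[OF dn] by simp
  qed
  define F where "F z = (\<Sum>n. of_real (d n) * (z - of_real t) ^ n)" for z :: complex
  have Fsums: "(\<lambda>n. of_real (d n) * (z - of_real t) ^ n) sums F z" if "z \<in> ball (of_real t) \<rho>" for z
  proof -
    have z: "norm (z - of_real t) < \<rho>" using that by (simp add: dist_norm norm_minus_commute)
    define x where "x = (norm (z - of_real t) + \<rho>) / 2"
    have x: "norm (z - of_real t) < x" "x < \<rho>" "x \<ge> 0" using z \<rho> by (auto simp: x_def)
    have "summable (\<lambda>n. of_real (d n * x ^ n) :: complex)"
      using sums[of x] x by (intro summable_of_real) (auto simp: sums_iff)
    then have "summable (\<lambda>n. of_real (d n) * (of_real x :: complex) ^ n)" by simp
    then have "summable (\<lambda>n. of_real (d n) * (z - of_real t) ^ n)"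
      by (rule powser_inside) (use x in simp)
    then show ?thesis unfolding F_def by (rule summable_sums)
  qed
  show ?thesis
    unfolding extends_holomorphically_at_def
  proof (intro exI[of _ \<rho>] exI[of _ F] conjI allI impI)
    show "F holomorphic_on ball (of_real t) \<rho>"
      by (rule power_series_holomorphic[OF Fsums])
    fix s assume s: "\<bar>s - t\<bar> < \<rho>"
    have "(\<lambda>n. of_real (d n * (s - t) ^ n) :: complex) sums of_real (f (b + (s - t) *\<^sub>R v))"
      using sums[OF s] by (rule sums_of_real)
    moreover have "(of_real s :: complex) \<in> ball (of_real t) \<rho>"
      using s by (simp add: dist_norm norm_minus_commute flip: of_real_diff)
    ultimately have "F (of_real s) = of_real (f (b + (s - t) *\<^sub>R v))"
      using Fsums[of "of_real s"] by (auto dest: sums_unique2)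
    also have "b + (s - t) *\<^sub>R v = a + s *\<^sub>R v" by (simp add: b_def algebra_simps)
    finally show "F (of_real s) = of_real (f (a + s *\<^sub>R v))" .
  qed (fact \<rho>)
qed

section \<open>Growth at a zero\<close>

lemma bounded_holomorphic_lipschitz_at_0:
  assumes hol: "\<phi> holomorphic_on ball 0 \<rho>" and "0 < \<rho>" and B: "\<And>t. t \<in> ball 0 \<rho> \<Longrightarrow> norm (\<phi> t) \<le> B"
    and t: "norm t < \<rho> / 2"
  shows "norm (\<phi> t - \<phi> 0) \<le> (4 * B / \<rho>) * norm t"
proof -
  have sub: "ball x (\<rho>/2) \<subseteq> ball 0 \<rho>" if "x \<in> ball 0 (\<rho>/2)" for x :: complex
  proof
    fix y assume "y \<in> ball x (\<rho>/2)"
    then show "y \<in> ball 0 \<rho>" using that dist_triangle[of 0 y x] by simp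
  qed
  have "norm (\<phi> t - \<phi> 0) \<le> (4 * B / \<rho>) * norm (t - 0)"
  proof (rule field_differentiable_bound[of "ball 0 (\<rho>/2)" _ "deriv \<phi>"])
    fix x :: complex assume x: "x \<in> ball 0 (\<rho>/2)"
    have "x \<in> ball 0 \<rho>" using sub[OF x] \<open>0 < \<rho>\<close> by (meson centre_in_ball half_gt_zero subsetD)
    from holomorphic_derivI[OF hol open_ball this]
    show "(\<phi> has_field_derivative deriv \<phi> x) (at x within ball 0 (\<rho>/2))"
      by (rule has_field_derivative_at_within)
    have "norm (deriv \<phi> x) \<le> 2 * B / (\<rho>/2)"
      by (rule norm_deriv_bound) (use holomorphic_on_subset[OF hol sub[OF x]] \<open>0 < \<rho>\<close> B sub[OF x] in auto)
    then show "norm (deriv \<phi> x) \<le> 4 * B / \<rho>" by simp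
  qed (use t \<open>0 < \<rho>\<close> in auto)
  then show ?thesis by simp
qed

text \<open>Comparison of orders of vanishing, in the form used for all three contradictions.\<close>

lemma power_growth_le:
  fixes c C \<epsilon> :: real
  assumes "c > 0" "\<epsilon> > 0" and le: "\<And>s. 0 < s \<Longrightarrow> s < \<epsilon> \<Longrightarrow> c * s ^ n \<le> C * s ^ k"
  shows "k \<le> n"
proof (rule ccontr)
  assume "\<not> k \<le> n"
  then obtain j where k: "k = n + Suc j" by (metis less_iff_Suc_add not_le add_Suc_right)
  have ev: "\<forall>\<^sub>F s in at_right 0. c \<le> C * s ^ Suc j"
    using eventually_at_right_real[OF assms(2)]
  proof eventually_elim
    case (elim s)
    have "s ^ n * c \<le> s ^ n * (C * s ^ Suc j)"
      using le[of s] elim by (simp add: k power_add mult_ac)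
    then show ?case using elim by (simp add: mult_le_cancel_left)
  qed
  have "((\<lambda>s. C * s ^ Suc j) \<longlongrightarrow> C * 0 ^ Suc j) (at_right 0)"
    by (intro tendsto_intros)
  then have "c \<le> C * 0 ^ Suc j"
    by (rule tendsto_lowerbound[OF _ ev]) simp
  then show False using assms(1) by simp
qed

lemma growth_at_simple_zero:
  assumes "(\<phi> has_field_derivative D) (at (0::complex))" "D \<noteq> 0" "\<phi> 0 = 0"
  obtains \<epsilon> where "\<epsilon> > 0" "\<And>t. norm t < \<epsilon> \<Longrightarrow> norm D / 2 * norm t \<le> norm (\<phi> t)"
proof -
  have "((\<lambda>t. norm (\<phi> t / t)) \<longlongrightarrow> norm D) (at 0)"
    using assms(1,3) by (intro tendsto_norm) (simp add: has_field_derivative_iff)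
  then have "\<forall>\<^sub>F t in at 0. norm D / 2 < norm (\<phi> t / t)"
    by (rule order_tendstoD(1)) (use assms(2) in simp)
  then obtain e where e: "e > 0" "\<And>t. t \<noteq> 0 \<Longrightarrow> norm t < e \<Longrightarrow> norm D / 2 < norm (\<phi> t / t)"
    unfolding eventually_at by (auto simp: dist_norm)
  show ?thesis
  proof (rule that[OF e(1)])
    fix t :: complex assume t: "norm t < e"
    show "norm D / 2 * norm t \<le> norm (\<phi> t)"
    proof (cases "t = 0")
      case False
      then have "norm D / 2 < norm (\<phi> t) / norm t" using e(2)[OF False t] by (simp add: norm_divide)
      then show ?thesis using False by (simp add: pos_less_divide_eq less_imp_le)
    qed (use assms(3) in simp)
  qed
qed

lemma growth_at_zero:
  assumes hol: "\<phi> holomorphic_on S" and S: "open S" "connected S" and \<xi>: "\<xi> \<in> S" "\<phi> \<xi> = 0"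
    and x: "x \<in> S" "\<phi> x \<noteq> 0"
  obtains n c \<epsilon> where "c > 0" "\<epsilon> > 0" "\<And>t. norm t < \<epsilon> \<Longrightarrow> c * norm t ^ n \<le> norm (\<phi> (\<xi> + t))"
proof -
  have "\<not> \<phi> constant_on S" using \<xi> x unfolding constant_on_def by metis
  then obtain g r n where gr: "0 < n" "0 < r" "ball \<xi> r \<subseteq> S" "g holomorphic_on ball \<xi> r"
    "\<And>w. w \<in> ball \<xi> r \<Longrightarrow> \<phi> w = (w - \<xi>) ^ n * g w" "\<And>w. w \<in> ball \<xi> r \<Longrightarrow> g w \<noteq> 0"
    using holomorphic_factor_zero_nonconstant[OF hol S \<xi>] by metis
  have g0: "g \<xi> \<noteq> 0" using gr(2,6) by simp
  have "isCont g \<xi>"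
    using holomorphic_on_imp_continuous_on[OF gr(4)] gr(2) by (simp add: continuous_on_eq_continuous_at)
  then have "((\<lambda>w. norm (g w)) \<longlongrightarrow> norm (g \<xi>)) (at \<xi>)"
    by (intro tendsto_norm) (simp add: continuous_at)
  then have "\<forall>\<^sub>F w in at \<xi>. norm (g \<xi>) / 2 < norm (g w)"
    by (rule order_tendstoD(1)) (use g0 in simp)
  then obtain e where e: "e > 0" "\<And>w. w \<noteq> \<xi> \<Longrightarrow> dist w \<xi> < e \<Longrightarrow> norm (g \<xi>) / 2 < norm (g w)"
    unfolding eventually_at by auto
  show ?thesis
  proof (rule that[of "norm (g \<xi>) / 2" "min e r" n])
    fix t :: complex assume t: "norm t < min e r"
    have "norm (g \<xi>) / 2 \<le> norm (g (\<xi> + t))"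
      using e(2)[of "\<xi> + t"] t by (cases "t = 0") (auto simp: dist_norm)
    then have "norm (g \<xi>) / 2 * norm t ^ n \<le> norm (g (\<xi> + t)) * norm t ^ n"
      by (rule mult_right_mono) simp
    also have "\<dots> = norm (\<phi> (\<xi> + t))"
      using gr(5)[of "\<xi> + t"] t by (simp add: dist_norm norm_mult norm_power mult.commute)
    finally show "norm (g \<xi>) / 2 * norm t ^ n \<le> norm (\<phi> (\<xi> + t))" .
  qed (use g0 e gr in auto)
qed

text \<open>A list of partial derivatives of length zero would give the infimum zero, and lists of length at least two alone an
infimum of at least two.\<close>

lemma vanishing_order_eq_1D:
  assumes "vanishing_order f z = 1"
  obtains j where "deriv (\<lambda>t. f (z + axis j t)) 0 \<noteq> 0"
proof (rule ccontr)
  assume no: "\<not> thesis"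
  define A where "A = {js. foldr complex_partial js f z \<noteq> 0}"
  have Inf: "(INF js\<in>A. enat (length js)) = 1"
    using assms by (simp add: vanishing_order_def A_def)
  have not1: "length js \<noteq> 1" if "js \<in> A" for js
  proof
    assume "length js = 1"
    then obtain j where "js = [j]" by (auto simp: length_Suc_conv)
    then have "deriv (\<lambda>t. f (z + axis j t)) 0 \<noteq> 0"
      using that by (simp add: A_def complex_partial_def)
    with no \<open>\<And>j. deriv (\<lambda>t. f (z + axis j t)) 0 \<noteq> 0 \<Longrightarrow> thesis\<close> show False by blast
  qed
  have not0: "length js \<noteq> 0" if "js \<in> A" for js
    using INF_lower[OF that, of "\<lambda>js. enat (length js)"] Inf by (auto simp: zero_enat_def[symmetric])
  have "enat 2 \<le> (INF js\<in>A. enat (length js))"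
  proof (rule INF_greatest)
    fix js assume "js \<in> A"
    then have "length js \<noteq> 0" "length js \<noteq> 1" by (rule not0, rule not1)
    then have "2 \<le> length js" by linarith
    then show "enat 2 \<le> enat (length js)" by simp
  qed
  then show False using Inf by (simp add: one_enat_def)
qed

section \<open>Consequences of real analyticity\<close>

context balanced_domain
begin

lemma K_along_ray_extends:
  assumes z: "z \<in> \<Omega>" "w \<in> \<Omega>" and t: "t \<in> {0..1}"
  shows "extends_holomorphically_at (\<lambda>s. K (of_real s *s w) z) t"
    and "extends_holomorphically_at (\<lambda>s. K (of_real (s\<^sup>2) *s w) z) t"
proof -
  define S where "S = {s. s *s w \<in> \<Omega>}"
  have "continuous_on UNIV (\<lambda>s. s *s w)" using continuous_on_complex_line[of UNIV 0 w] by simp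
  then have S: "open S" unfolding S_def using open_vimage[OF open_\<Omega>] by (simp add: vimage_def)
  have hol: "(\<lambda>s. K (s *s w) z) holomorphic_on S"
    using holomorphic_on_complex_line[OF K_holomorphic[OF z(1)], of S 0 w] by (simp add: S_def)
  show "extends_holomorphically_at (\<lambda>s. K (of_real s *s w) z) t"
    by (rule extends_holomorphically_atI[OF S _ hol]) (use t real_scale_\<Omega>[OF z(2), of t] in \<open>auto simp: S_def\<close>)
  have "of_real (t\<^sup>2) *s w \<in> \<Omega>"
    using t real_scale_\<Omega>[OF z(2), of "t\<^sup>2"] by (simp add: power_le_one)
  moreover have "open ((\<lambda>s::complex. s\<^sup>2) -` S)"
    by (intro open_vimage S continuous_intros)
  moreover have "(\<lambda>s. K (s\<^sup>2 *s w) z) holomorphic_on (\<lambda>s. s\<^sup>2) -` S"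
    by (rule holomorphic_on_compose_gen[OF _ hol, unfolded o_def]) (auto intro!: holomorphic_intros)
  ultimately show "extends_holomorphically_at (\<lambda>s. K (of_real (s\<^sup>2) *s w) z) t"
    by (intro extends_holomorphically_atI[of "(\<lambda>s. s\<^sup>2) -` S" _ "\<lambda>s. K (s\<^sup>2 *s w) z"]) (auto simp: S_def)
qed

lemma scaleR_eq_vector_scalar_mult: "t *\<^sub>R (z :: complex ^ 'n) = of_real t *s z"
proof -
  have "(t *\<^sub>R z) $ i = (of_real t *s z) $ i" for i
    unfolding vector_scaleR_component vector_smult_component by (rule scaleR_conv_of_real)
  then show ?thesis by (simp only: vec_eq_iff simp_thms)
qed

text \<open>Both sides of \<open>K\<^sub>p(t z) = K(t\<^sup>2 z, z)\<close> continue analytically in the real parameter \<open>t\<close>. They agree for small \<open>t\<close> by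
\<open>minimizer_of_Re_pos\<close>, hence at \<open>t = 1\<close>.\<close>

lemma min_int_eq_of_real_analytic:
  assumes p: "p > 2" and ra: "(\<lambda>z. K_diag \<Omega> p z) real_analytic_on \<Omega>" and z: "z \<in> \<Omega>"
  shows "min_int p z = min_int 2 z"
proof -
  define \<phi> where "\<phi> s = of_real (K_diag \<Omega> p (of_real s *s z)) - K (of_real (s\<^sup>2) *s z) z" for s
  obtain \<delta> where \<delta>: "0 < \<delta>" "\<delta> \<le> 1"
    "\<And>t \<zeta>. 0 \<le> t \<Longrightarrow> t \<le> \<delta> \<Longrightarrow> \<zeta> \<in> \<Omega> \<Longrightarrow> Re (m (of_real t *s z) \<zeta>) > 0"
    using Re_m_pos_near_zero[OF z] by blast
  have "\<phi> 1 = 0"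
  proof (rule extends_holomorphically_at_zero_propagates[OF _ _ \<delta>(1,2)])
    fix t :: real assume t: "t \<in> {0..1}"
    have "extends_holomorphically_at (\<lambda>s. of_real (K_diag \<Omega> p (0 + s *\<^sub>R z))) t"
      by (rule real_analytic_on_line[OF ra]) (use real_scale_\<Omega>[OF z] t in \<open>auto simp: scaleR_eq_vector_scalar_mult\<close>)
    then show "extends_holomorphically_at \<phi> t"
      unfolding \<phi>_def by (intro extends_holomorphically_at_diff K_along_ray_extends z t)
        (simp add: scaleR_eq_vector_scalar_mult)
  next
    fix t assume t: "0 < t" "t < \<delta>"
    have tz: "of_real t *s z \<in> \<Omega>" using t \<delta>(2) by (intro real_scale_\<Omega>[OF z]) auto
    have "min_int p (of_real t *s z) = min_int 2 (of_real t *s z)"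
      by (rule minimizer_of_Re_pos(1)[OF tz _ p]) (use \<delta>(3) t in auto)
    then show "\<phi> t = 0"
      using min_int2_real_dilation[OF z, of t] t \<delta>(2) by (simp add: \<phi>_def K_diag_eq)
  qed
  then have "inverse (min_int p z) = inverse (min_int 2 z)"
    using K_self[OF z] by (simp add: \<phi>_def K_diag_eq del: of_real_inverse flip: of_real_diff)
  then show ?thesis by simp
qed

text \<open>If \<open>f\<^sub>n\<close> is a minimizing sequence for the exponent \<open>2k\<close>, then equality of the minima makes \<open>f\<^sub>n ^ k\<close> a minimizing
sequence for the exponent two, so \<open>f\<^sub>n ^ k\<close> converges to \<open>m z\<close>. The \<open>f\<^sub>n\<close> are uniformly bounded near \<open>a\<close>, hence
uniformly Lipschitz on the line through \<open>a\<close>, and \<open>f\<^sub>n a \<longlonglongrightarrow> 0\<close>; the bound for the limit follows.\<close>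

lemma m_vanishes_to_order:
  assumes k: "k > 0" and z: "z \<in> \<Omega>" and eq: "min_int (2 * real k) z = min_int 2 z" and a: "a \<in> \<Omega>" and zero: "m z a = 0"
  obtains \<rho> C where "\<rho> > 0" "C \<ge> 0" "\<And>t. norm t < \<rho> \<Longrightarrow> a + t *s h \<in> \<Omega> \<and> norm (m z (a + t *s h)) \<le> (C * norm t) ^ k"
proof -
  have "\<forall>n. \<exists>f. f \<in> bergman_space \<Omega> (2 * real k) \<and> f z = 1 \<and> Lp_int (2 * real k) f < min_int 2 z + 1 / real (Suc n)"
  proof
    fix n
    show "\<exists>f. f \<in> bergman_space \<Omega> (2 * real k) \<and> f z = 1 \<and> Lp_int (2 * real k) f < min_int 2 z + 1 / real (Suc n)"
      using min_int_approx[of "2 * real k" z "min_int 2 z + 1 / real (Suc n)"] k eq by force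
  qed
  from choice[OF this] obtain f where f: "\<And>n. f n \<in> bergman_space \<Omega> (2 * real k)" "\<And>n. f n z = 1"
      "\<And>n. Lp_int (2 * real k) (f n) < min_int 2 z + 1 / real (Suc n)"
    by blast
  have pw: "norm (x ^ k) powr 2 = norm x powr (2 * real k)" for x :: complex
    using k by (cases "x = 0") (simp_all add: norm_power powr_realpow[symmetric] powr_powr mult.commute flip: powr_numeral)
  define g where "g n = (\<lambda>x. f n x ^ k)" for n
  have fhol: "f n holomorphic_Cn_on \<Omega>" for n using f(1) by (simp add: bergman_space_iff)
  have gA: "g n \<in> A2" for n
    using f(1)[of n] unfolding bergman_space_iff g_def pw by (auto intro: holomorphic_Cn_power)
  have Ig: "Lp_int 2 (g n) = Lp_int (2 * real k) (f n)" for n unfolding Lp_int_def g_def pw ..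
  have gz: "g n z = 1" for n by (simp add: g_def f)
  have lim: "(\<lambda>n. Lp_int 2 (g n)) \<longlonglongrightarrow> min_int 2 z"
  proof (rule tendsto_sandwich)
    show "\<forall>\<^sub>F n in sequentially. min_int 2 z \<le> Lp_int 2 (g n)"
      using gA gz min_int_le by (intro always_eventually) auto
    show "\<forall>\<^sub>F n in sequentially. Lp_int 2 (g n) \<le> min_int 2 z + 1 / real (Suc n)"
      using f(3) by (intro always_eventually) (auto intro: less_imp_le simp: Ig)
    show "(\<lambda>n. min_int 2 z + 1 / real (Suc n)) \<longlonglongrightarrow> min_int 2 z"
      using LIMSEQ_Suc[OF lim_inverse_n'] tendsto_add[OF tendsto_const, of "\<lambda>n. 1 / real (Suc n)" 0 sequentially "min_int 2 z"]
      by simp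
  qed simp
  have conv: "(\<lambda>n. g n x) \<longlonglongrightarrow> m z x" if "x \<in> \<Omega>" for x
    by (rule minimizing_sequence_tendsto_m[OF z gA gz lim that])
  obtain r where r: "r > 0" "cball a r \<subseteq> \<Omega>" using cball_subset_\<Omega>[OF a] by blast
  define \<rho> where "\<rho> = r / 2 / (norm h + 1)"
  have h1: "norm h + 1 > 0" by (simp add: add_nonneg_pos)
  have \<rho>: "\<rho> > 0" using r h1 by (simp add: \<rho>_def)
  have near: "cball (a + t *s h) (r/2) \<subseteq> \<Omega>" if "norm t < \<rho>" for t
  proof
    fix y assume y: "y \<in> cball (a + t *s h) (r/2)"
    have "norm t * norm h \<le> norm t * (norm h + 1)" by (simp add: mult_left_mono)
    also have "\<dots> < r / 2" using that h1 by (simp add: \<rho>_def field_simps)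
    finally have "dist a (a + t *s h) < r / 2" by (simp add: dist_norm norm_vector_scalar_mult)
    then have "dist a y \<le> r" using y dist_triangle[of a y "a + t *s h"] by simp
    then show "y \<in> \<Omega>" using r(2) by auto
  qed
  have inO: "a + t *s h \<in> \<Omega>" if "norm t < \<rho>" for t
    using near[OF that] r(1) by auto
  \<comment> \<open>As \<open>B \<ge> 1\<close>, a bound \<open>\<bar>f\<^sub>n\<bar> ^ k \<le> B\<close> implies \<open>\<bar>f\<^sub>n\<bar> \<le> B\<close>.\<close>
  define B where "B = max 1 (sqrt ((min_int 2 z + 1) / vol_cball (r/2)))"
  have fB: "norm (f n (a + t *s h)) \<le> B" if "norm t < \<rho>" for n t
  proof (rule ccontr)
    let ?y = "norm (f n (a + t *s h))"
    assume "\<not> ?y \<le> B"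
    then have y: "1 \<le> ?y" "B < ?y" by (auto simp: B_def)
    have "?y \<le> ?y ^ k" using power_increasing[of 1 k ?y] y k by simp
    then have "B < norm (g n (a + t *s h))" using y by (simp add: g_def norm_power)
    then have "sqrt ((min_int 2 z + 1) / vol_cball (r/2)) < norm (g n (a + t *s h))" by (simp add: B_def)
    then have "(min_int 2 z + 1) / vol_cball (r/2) < (norm (g n (a + t *s h)))\<^sup>2"
      by (meson not_le real_le_rsqrt)
    then have "min_int 2 z + 1 < (norm (g n (a + t *s h)))\<^sup>2 * vol_cball (r/2)"
      using vol_cball_pos[of "r/2"] r(1) by (simp add: field_simps)
    also have "\<dots> \<le> Lp_int 2 (g n)"
      using pointwise_le_Lp_int2[OF gA near[OF that]] r(1) by simp
    also have "\<dots> \<le> min_int 2 z + 1"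
      using f(3)[of n] by (simp add: Ig order_trans[OF less_imp_le])
    finally show False by simp
  qed
  define C where "C = 4 * B / \<rho>"
  have C: "C \<ge> 0" using \<rho> by (simp add: C_def B_def)
  have lip: "norm (f n (a + t *s h) - f n a) \<le> C * norm t" if "norm t < \<rho> / 2" for n t
  proof -
    have "(\<lambda>t. f n (a + t *s h)) holomorphic_on ball 0 \<rho>"
      by (rule holomorphic_on_complex_line[OF fhol]) (use inO in auto)
    from bounded_holomorphic_lipschitz_at_0[OF this \<rho>, of B t] that fB show ?thesis
      by (simp add: C_def)
  qed
  have fa: "(\<lambda>n. norm (f n a)) \<longlonglongrightarrow> 0"
  proof -
    have "(\<lambda>n. root k (norm (g n a))) \<longlonglongrightarrow> root k (norm (m z a))"
      by (intro tendsto_intros conv[OF a])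
    then show ?thesis using k zero by (simp add: g_def norm_power real_root_power_cancel)
  qed
  show ?thesis
  proof (rule that[of "\<rho>/2" C])
    fix t :: complex assume t: "norm t < \<rho> / 2"
    then have t': "norm t < \<rho>" using \<rho> by simp
    have "norm (m z (a + t *s h)) \<le> (C * norm t + 0) ^ k"
    proof (rule tendsto_le[OF sequentially_bot])
      show "(\<lambda>n. (C * norm t + norm (f n a)) ^ k) \<longlonglongrightarrow> (C * norm t + 0) ^ k"
        by (intro tendsto_intros fa)
      show "(\<lambda>n. norm (g n (a + t *s h))) \<longlonglongrightarrow> norm (m z (a + t *s h))"
        by (intro tendsto_intros conv inO t')
      show "\<forall>\<^sub>F n in sequentially. norm (g n (a + t *s h)) \<le> (C * norm t + norm (f n a)) ^ k"
      proof (intro always_eventually allI)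
        fix n
        have "norm (f n (a + t *s h)) \<le> norm (f n (a + t *s h) - f n a) + norm (f n a)"
          using norm_triangle_ineq[of "f n (a + t *s h) - f n a" "f n a"] by simp
        also have "\<dots> \<le> C * norm t + norm (f n a)" using lip[OF t] by simp
        finally show "norm (g n (a + t *s h)) \<le> (C * norm t + norm (f n a)) ^ k"
          by (simp add: g_def norm_power power_mono)
      qed
    qed
    then show "a + t *s h \<in> \<Omega> \<and> norm (m z (a + t *s h)) \<le> (C * norm t) ^ k"
      using inO[OF t'] by simp
  qed (use \<rho> C in auto)
qed

lemma power_le_order_of_zero:
  assumes k: "k \<ge> 2" and ra: "(\<lambda>z. K_diag \<Omega> (2 * real k) z) real_analytic_on \<Omega>"
    and z: "z \<in> \<Omega>" and a: "a \<in> \<Omega>" and zero: "m z a = 0"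
    and c: "c > 0" "\<epsilon> > 0" "\<And>t. norm t < \<epsilon> \<Longrightarrow> c * norm t ^ n \<le> norm (m z (a + t *s h))"
  shows "k \<le> n"
proof -
  have "min_int (2 * real k) z = min_int 2 z" using min_int_eq_of_real_analytic[OF _ ra z] k by simp
  then obtain \<rho> C where \<rho>: "\<rho> > 0" "C \<ge> 0"
    "\<And>t. norm t < \<rho> \<Longrightarrow> a + t *s h \<in> \<Omega> \<and> norm (m z (a + t *s h)) \<le> (C * norm t) ^ k"
    using m_vanishes_to_order[OF _ z _ a zero, of k h] k by auto
  show ?thesis
  proof (rule power_growth_le[of c "min \<epsilon> \<rho>" n "C ^ k" k])
    fix s :: real assume s: "0 < s" "s < min \<epsilon> \<rho>"
    have "c * norm (of_real s :: complex) ^ n \<le> (C * norm (of_real s :: complex)) ^ k"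
      using c(3)[of "of_real s"] \<rho>(3)[of "of_real s"] s by simp
    then show "c * s ^ n \<le> C ^ k * s ^ k" using s by (simp add: power_mult_distrib)
  qed (use c \<rho> in auto)
qed

text \<open>The order of the zero is measured on the complex line through the origin and \<open>z\<close>. There the minimizer cannot vanish
identically, as it is nonzero at the origin.\<close>

lemma eventually_not_real_analytic:
  assumes z: "z \<in> \<Omega>" and w: "w \<in> \<Omega>" and zero: "K z w = 0"
  shows "\<exists>k0::nat. k0 > 0 \<and> (\<forall>k\<ge>k0. \<not> (\<lambda>z. K_diag \<Omega> (2 * real k) z) real_analytic_on \<Omega>)"
proof -
  have mz: "m w z = 0" using zero min_int2_pos[OF w] by (simp add: K_def)
  define S where "S = {t. t *s z \<in> \<Omega>}"
  have "continuous_on UNIV (\<lambda>s. s *s z)" using continuous_on_complex_line[of UNIV 0 z] by simp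
  then have S: "open S" unfolding S_def using open_vimage[OF open_\<Omega>] by (simp add: vimage_def)
  have "starlike S"
    unfolding starlike_def
  proof (intro bexI[of _ 0] ballI)
    fix x assume x: "x \<in> S"
    show "closed_segment 0 x \<subseteq> S"
    proof
      fix y assume "y \<in> closed_segment 0 x"
      then obtain u where u: "0 \<le> u" "u \<le> 1" "y = of_real u * x"
        by (auto simp: closed_segment_def scaleR_conv_of_real)
      then show "y \<in> S"
        using real_scale_\<Omega>[of "x *s z" u] x by (simp add: S_def)
    qed
  qed (use zero_in_\<Omega> in \<open>simp add: S_def\<close>)
  then have conn: "connected S" by (rule starlike_imp_connected)
  have hol: "(\<lambda>t. m w (t *s z)) holomorphic_on S"
    using holomorphic_on_complex_line[OF m_holomorphic[OF w], of S 0 z] by (simp add: S_def)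
  have m0: "m w 0 \<noteq> 0" using K_zero[OF w] min_int2_pos[OF zero_in_\<Omega>] by (auto simp: K_def)
  obtain n c \<epsilon> where c: "c > 0" "\<epsilon> > 0" "\<And>t. norm t < \<epsilon> \<Longrightarrow> c * norm t ^ n \<le> norm (m w ((1 + t) *s z))"
    by (rule growth_at_zero[OF hol S conn, of 1 0]) (use z mz m0 zero_in_\<Omega> in \<open>auto simp: S_def\<close>)
  show ?thesis
    \<comment> \<open>Beyond exceeding the order \<open>n\<close>, \<open>k\<close> must be at least \<open>2\<close> for the exponent \<open>2k\<close> to exceed two.\<close>
  proof (intro exI[of _ "n + 2"] conjI allI impI notI)
    fix k assume k: "n + 2 \<le> k" and ra: "(\<lambda>z. K_diag \<Omega> (2 * real k) z) real_analytic_on \<Omega>"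
    have "k \<le> n"
    proof (rule power_le_order_of_zero[OF _ ra w z mz c(1,2), of n z])
      show "c * norm t ^ n \<le> norm (m w (z + t *s z))" if "norm t < \<epsilon>" for t
        using c(3)[OF that] by (simp add: vector_sadd_rdistrib)
    qed (use k in simp)
    with k show False by simp
  qed simp
qed

text \<open>By Hermitian symmetry the conjugate of \<open>K \<zeta>0 \<cdot>\<close> is the holomorphic function \<open>K \<cdot> \<zeta>0\<close>, to which the
hypothesis on the order applies.\<close>

lemma simple_zero_growth:
  assumes \<zeta>0: "\<zeta>0 \<in> \<Omega>" and z0: "z0 \<in> \<Omega>" and zero: "K \<zeta>0 z0 = 0"
    and ord: "vanishing_order (\<lambda>w. cnj (K_off \<Omega> 2 \<zeta>0 w)) z0 = 1"
  shows "\<exists>j. \<exists>c>0. \<exists>\<epsilon>>0. \<forall>t. norm t < \<epsilon> \<longrightarrow>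
    z0 + t *s axis j 1 \<in> \<Omega> \<and> c * norm t \<le> norm (K (z0 + t *s axis j 1) \<zeta>0)"
proof -
  obtain j where j: "deriv (\<lambda>t. cnj (K_off \<Omega> 2 \<zeta>0 (z0 + axis j t))) 0 \<noteq> 0"
    using vanishing_order_eq_1D[OF ord] by blast
  define S where "S = {t. z0 + t *s axis j (1::complex) \<in> \<Omega>}"
  have S: "open S" unfolding S_def
    using open_vimage[OF open_\<Omega> continuous_on_complex_line[of UNIV z0 "axis j 1"]] by (simp add: vimage_def)
  have S0: "0 \<in> S" using z0 by (simp add: S_def)
  define \<phi> where "\<phi> t = K (z0 + t *s axis j 1) \<zeta>0" for t
  have hol: "\<phi> holomorphic_on S"
    unfolding \<phi>_def by (rule holomorphic_on_complex_line[OF K_holomorphic[OF \<zeta>0]]) (simp add: S_def)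
  have ax: "axis j t = t *s axis j (1::complex)" for t by (simp add: vec_eq_iff axis_def)
  have "\<forall>\<^sub>F t in nhds 0. cnj (K_off \<Omega> 2 \<zeta>0 (z0 + axis j t)) = \<phi> t"
    using eventually_nhds_in_open[OF S S0]
  proof eventually_elim
    case (elim t)
    then show ?case
      using K_cnj[OF \<zeta>0, of "z0 + t *s axis j 1"] by (simp add: K_off_eq \<phi>_def ax[of t] S_def)
  qed
  from deriv_cong_ev[OF this refl] j have D: "deriv \<phi> 0 \<noteq> 0" by simp
  have \<phi>0: "\<phi> 0 = 0" using zero K_cnj[OF \<zeta>0 z0] by (simp add: \<phi>_def)
  obtain e where e: "e > 0" "\<And>t. norm t < e \<Longrightarrow> norm (deriv \<phi> 0) / 2 * norm t \<le> norm (\<phi> t)"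
    using growth_at_simple_zero[OF holomorphic_derivI[OF hol S S0] D \<phi>0] by blast
  obtain r where r: "r > 0" "ball 0 r \<subseteq> S" using S S0 open_contains_ball by blast
  have "z0 + t *s axis j 1 \<in> \<Omega> \<and> norm (deriv \<phi> 0) / 2 * norm t \<le> norm (K (z0 + t *s axis j 1) \<zeta>0)"
    if t: "norm t < min e r" for t :: complex
  proof -
    have "t \<in> S" using t r(2) by auto
    then show ?thesis using e(2)[of t] t by (simp add: S_def \<phi>_def)
  qed
  moreover have "norm (deriv \<phi> 0) / 2 > 0" "min e r > 0" using D e r by auto
  ultimately show ?thesis by blast
qed

lemma not_real_analytic_of_simple_zero:
  assumes \<zeta>0: "\<zeta>0 \<in> \<Omega>" and z0: "z0 \<in> \<Omega>" and zero: "K \<zeta>0 z0 = 0"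
    and ord: "vanishing_order (\<lambda>w. cnj (K_off \<Omega> 2 \<zeta>0 w)) z0 = 1" and k: "k \<ge> 2"
  shows "\<not> (\<lambda>z. K_diag \<Omega> (2 * real k) z) real_analytic_on \<Omega>"
proof
  assume ra: "(\<lambda>z. K_diag \<Omega> (2 * real k) z) real_analytic_on \<Omega>"
  obtain j c \<epsilon> where c: "c > 0" "\<epsilon> > 0"
    "\<forall>t. norm t < \<epsilon> \<longrightarrow> z0 + t *s axis j 1 \<in> \<Omega> \<and> c * norm t \<le> norm (K (z0 + t *s axis j 1) \<zeta>0)"
    using simple_zero_growth[OF \<zeta>0 z0 zero ord] by (elim exE conjE)
  have M: "min_int 2 \<zeta>0 > 0" by (rule min_int2_pos[OF \<zeta>0])
  have "K z0 \<zeta>0 = 0" using zero K_cnj[OF \<zeta>0 z0] by simp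
  then have "m \<zeta>0 z0 = 0" using M by (simp add: K_def)
  then have "k \<le> 1"
  proof (rule power_le_order_of_zero[OF k ra \<zeta>0 z0, of "c * min_int 2 \<zeta>0" \<epsilon> 1 "axis j 1"])
    fix t :: complex assume "norm t < \<epsilon>"
    then have "c * norm t \<le> norm (K (z0 + t *s axis j 1) \<zeta>0)" using c(3) by blast
    then show "c * min_int 2 \<zeta>0 * norm t ^ 1 \<le> norm (m \<zeta>0 (z0 + t *s axis j 1))"
      using M by (simp add: K_def norm_divide pos_le_divide_eq mult_ac)
  qed (use c M in auto)
  with k show False by simp
qed

text \<open>Near the origin \<open>m\<^sub>p = m ^ (b / a)\<close> by \<open>minimizer_of_Re_pos\<close>. Taking \<open>a\<close>-th powers and clearing the denominator
\<open>K z z\<close> of \<open>m z\<close> leaves an identity between functions that continue analytically along segments from the origin.\<close>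

lemma m_off_power_eq:
  assumes ab: "p > 2" "p * real b = 2 * real a" and b: "b > 0"
    and raR: "(\<lambda>z. Re (m_off \<Omega> p \<zeta> z)) real_analytic_on \<Omega>"
    and raI: "(\<lambda>z. Im (m_off \<Omega> p \<zeta> z)) real_analytic_on \<Omega>"
    and \<zeta>: "\<zeta> \<in> \<Omega>" and z: "z \<in> \<Omega>"
  shows "m_off \<Omega> p \<zeta> z ^ a * K z z ^ b = K \<zeta> z ^ b"
proof -
  define \<phi> where "\<phi> s = m_off \<Omega> p \<zeta> (of_real s *s z) ^ a * K (of_real (s\<^sup>2) *s z) z ^ b
      - K (of_real s *s \<zeta>) z ^ b" for s
  obtain \<delta> where \<delta>: "0 < \<delta>" "\<delta> \<le> 1"
    "\<And>t \<zeta>. 0 \<le> t \<Longrightarrow> t \<le> \<delta> \<Longrightarrow> \<zeta> \<in> \<Omega> \<Longrightarrow> Re (m (of_real t *s z) \<zeta>) > 0"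
    using Re_m_pos_near_zero[OF z] by blast
  have "\<phi> 1 = 0"
  proof (rule extends_holomorphically_at_zero_propagates[OF _ _ \<delta>(1,2)])
    fix t :: real assume t: "t \<in> {0..1}"
    have tz: "0 + t *\<^sub>R z \<in> \<Omega>" using real_scale_\<Omega>[OF z] t by (auto simp: scaleR_eq_vector_scalar_mult)
    have "extends_holomorphically_at (\<lambda>s. of_real (Re (m_off \<Omega> p \<zeta> (0 + s *\<^sub>R z)))
        + \<i> * of_real (Im (m_off \<Omega> p \<zeta> (0 + s *\<^sub>R z)))) t"
      by (rule extends_holomorphically_at_combine[OF real_analytic_on_line[OF raR tz] real_analytic_on_line[OF raI tz]])
        (intro holomorphic_intros)
    then have "extends_holomorphically_at (\<lambda>s. m_off \<Omega> p \<zeta> (of_real s *s z)) t"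
      by (simp add: scaleR_eq_vector_scalar_mult flip: complex_eq)
    then show "extends_holomorphically_at \<phi> t"
      unfolding \<phi>_def
      by (intro extends_holomorphically_at_diff extends_holomorphically_at_mult
          extends_holomorphically_at_power K_along_ray_extends z \<zeta> t)
  next
    fix t assume t: "0 < t" "t < \<delta>"
    define w where "w = of_real t *s z"
    have w: "w \<in> \<Omega>" unfolding w_def using t \<delta>(2) by (intro real_scale_\<Omega>[OF z]) auto
    have pos: "Re (m w x) > 0" if "x \<in> \<Omega>" for x
      unfolding w_def by (rule \<delta>(3)) (use t that in auto)
    have mn0: "m w \<zeta> \<noteq> 0" using pos[OF \<zeta>] by auto
    have "m_off \<Omega> p \<zeta> w ^ a = (m w \<zeta> powr of_real (2 / p)) ^ a"
      using minimizer_of_Re_pos(2)[OF w pos ab(1) \<zeta>] by simp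
    also have "\<dots> = m w \<zeta> powr (of_real (real a * (2 / p)))"
      using mn0 by (simp add: powr_power)
    also have "real a * (2 / p) = real b" using ab by (simp add: field_simps)
    also have "m w \<zeta> powr of_real (real b) = m w \<zeta> ^ b" using mn0 by (simp add: powr_nat')
    finally have "m_off \<Omega> p \<zeta> w ^ a * K w w ^ b = (m w \<zeta> * K w w) ^ b"
      by (simp add: power_mult_distrib)
    also have "m w \<zeta> * K w w = K \<zeta> w" by (simp add: K_def m_self[OF w])
    finally show "\<phi> t = 0"
      using min_int2_real_dilation[OF z, of t] K_self[OF w] K_real_dilation[OF z \<zeta>, of t] t \<delta>(2)
      by (simp add: \<phi>_def w_def)
  qed
  then show ?thesis
    using K_real_dilation[OF z \<zeta>, of 1] by (simp add: \<phi>_def)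
qed

lemma K_diag_bounded_near:
  assumes a: "a \<in> \<Omega>"
  obtains r B where "r > 0" "\<And>x. dist a x < r \<Longrightarrow> x \<in> \<Omega> \<and> norm (K x x) \<le> B"
proof -
  obtain r where r: "r > 0" "cball a r \<subseteq> \<Omega>" using cball_subset_\<Omega>[OF a] by blast
  show ?thesis
  proof (rule that[of "r/2" "inverse (vol_cball (r/2))"])
    fix x assume x: "dist a x < r / 2"
    have sub: "cball x (r/2) \<subseteq> \<Omega>"
    proof
      fix y assume "y \<in> cball x (r/2)"
      then have "dist a y \<le> r" using x dist_triangle[of a y x] by simp
      then show "y \<in> \<Omega>" using r(2) by auto
    qed
    then have xO: "x \<in> \<Omega>" using r(1) by auto
    have "vol_cball (r/2) \<le> min_int 2 x"
      using pointwise_le_Lp_int2[OF m_A2[OF xO] sub] r(1) by (simp add: m_self[OF xO] Lp_int2_m[OF xO])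
    then have "norm (K x x) \<le> inverse (vol_cball (r/2))"
      using vol_cball_pos[of "r/2"] r(1) min_int2_pos[OF xO] by (simp add: K_self[OF xO] norm_inverse le_imp_inverse_le)
    with xO show "x \<in> \<Omega> \<and> norm (K x x) \<le> inverse (vol_cball (r/2))" by simp
  qed (use r in simp)
qed

text \<open>A real-analytic \<open>m\<^sub>p(\<zeta>0, \<cdot>)\<close> is Lipschitz at its zero \<open>z0\<close>. In \<open>m_off_power_eq\<close> the left-hand side is then at most of the
order of the \<open>a\<close>-th power of the distance, the right-hand side on a suitable line at least of the order of the \<open>b\<close>-th power, but \<open>b < a\<close>.\<close>

lemma m_off_not_real_analytic:
  assumes \<zeta>0: "\<zeta>0 \<in> \<Omega>" and z0: "z0 \<in> \<Omega>" and zero: "K \<zeta>0 z0 = 0"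
    and ord: "vanishing_order (\<lambda>w. cnj (K_off \<Omega> 2 \<zeta>0 w)) z0 = 1"
    and p: "p \<in> \<rat>" "p > 2"
  shows "\<not> (\<lambda>z. Re (m_off \<Omega> p \<zeta>0 z)) real_analytic_on \<Omega> \<or> \<not> (\<lambda>z. Im (m_off \<Omega> p \<zeta>0 z)) real_analytic_on \<Omega>"
proof (rule ccontr)
  assume "\<not> ?thesis"
  then have raR: "(\<lambda>z. Re (m_off \<Omega> p \<zeta>0 z)) real_analytic_on \<Omega>"
    and raI: "(\<lambda>z. Im (m_off \<Omega> p \<zeta>0 z)) real_analytic_on \<Omega>" by auto
  obtain x y :: nat where xy: "y \<noteq> 0" "\<bar>p\<bar> = real x / real y"
    using p(1) by (rule Rats_abs_nat_div_natE)
  define a where "a = x"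
  \<comment> \<open>With \<open>p = x / y\<close> this gives \<open>2 / p = b / a\<close>.\<close>
  define b where "b = 2 * y"
  have ab: "p * real b = 2 * real a" "b > 0" using xy p(2) by (auto simp: a_def b_def field_simps)
  have "2 * real b < p * real b" using ab(2) p(2) by simp
  then have ba: "b < a" using ab(1) by simp
  note eq = m_off_power_eq[OF p(2) ab raR raI \<zeta>0]
  obtain j c \<epsilon> where c: "c > 0" "\<epsilon> > 0"
    "\<forall>t. norm t < \<epsilon> \<longrightarrow> z0 + t *s axis j 1 \<in> \<Omega> \<and> c * norm t \<le> norm (K (z0 + t *s axis j 1) \<zeta>0)"
    using simple_zero_growth[OF \<zeta>0 z0 zero ord] by (elim exE conjE)
  define P where "P s = z0 + s *\<^sub>R axis j (1::complex)" for s :: real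
  have P: "P s = z0 + of_real s *s axis j 1" for s by (simp add: P_def scaleR_eq_vector_scalar_mult)
  have P0: "z0 + 0 *\<^sub>R axis j (1::complex) \<in> \<Omega>" using z0 by simp
  have "extends_holomorphically_at (\<lambda>s. of_real (Re (m_off \<Omega> p \<zeta>0 (P s))) + \<i> * of_real (Im (m_off \<Omega> p \<zeta>0 (P s)))) 0"
    unfolding P_def
    by (rule extends_holomorphically_at_combine[OF real_analytic_on_line[OF raR P0] real_analytic_on_line[OF raI P0]])
      (intro holomorphic_intros)
  then have "extends_holomorphically_at (\<lambda>s. m_off \<Omega> p \<zeta>0 (P s)) 0"
    by (simp flip: complex_eq)
  then obtain \<rho> F where \<rho>: "\<rho> > 0" "F holomorphic_on ball 0 \<rho>"
      "\<And>s. \<bar>s\<bar> < \<rho> \<Longrightarrow> F (of_real s) = m_off \<Omega> p \<zeta>0 (P s)"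
    unfolding extends_holomorphically_at_def by auto
  have Kz0: "K z0 z0 \<noteq> 0" using K_self[OF z0] min_int2_pos[OF z0] by simp
  have "m_off \<Omega> p \<zeta>0 z0 ^ a * K z0 z0 ^ b = 0" using eq[OF z0] zero ab(2) by simp
  then have F0: "F 0 = 0" using \<rho>(3)[of 0] \<rho>(1) Kz0 by (simp add: P_def)
  have "bounded (F ` cball 0 (\<rho>/2))"
    by (intro compact_imp_bounded compact_continuous_image holomorphic_on_imp_continuous_on
        holomorphic_on_subset[OF \<rho>(2)]) (use \<rho>(1) in auto)
  then obtain B where B: "\<And>t. t \<in> cball 0 (\<rho>/2) \<Longrightarrow> norm (F t) \<le> B"
    unfolding bounded_iff by blast
  define C where "C = 4 * B / (\<rho>/2)"
  have "norm (F 0) \<le> B" by (rule B) (use \<rho>(1) in simp)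
  then have C: "C \<ge> 0" using F0 \<rho>(1) by (simp add: C_def)
  have lip: "norm (F t) \<le> C * norm t" if "norm t < \<rho>/2/2" for t
    using bounded_holomorphic_lipschitz_at_0[of F "\<rho>/2" B t] that \<rho>(1) B F0
      holomorphic_on_subset[OF \<rho>(2) subset_ball, of "\<rho>/2"]
    by (simp add: C_def)
  obtain r D where r: "r > 0" "\<And>x. dist z0 x < r \<Longrightarrow> x \<in> \<Omega> \<and> norm (K x x) \<le> D"
    using K_diag_bounded_near[OF z0] by blast
  define \<epsilon>' where "\<epsilon>' = min \<epsilon> (min (\<rho>/2/2) r)"
  have "a \<le> b"
  proof (rule power_growth_le[of "c ^ b" \<epsilon>' b "C ^ a * D ^ b" a])
    fix s :: real assume s: "0 < s" "s < \<epsilon>'"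
    have ns: "norm (of_real s :: complex) = s" using s by simp
    have Ps: "P s \<in> \<Omega>" "c * s \<le> norm (K (P s) \<zeta>0)"
      using c(3)[rule_format, of "of_real s"] s by (auto simp: P \<epsilon>'_def)
    have KD: "norm (K (P s) (P s)) \<le> D"
      using r(2)[of "P s"] s by (simp add: P_def dist_norm \<epsilon>'_def norm_axis_1)
    have "F (of_real s) = m_off \<Omega> p \<zeta>0 (P s)" using \<rho>(3)[of s] s \<rho>(1) by (simp add: \<epsilon>'_def)
    then have Fs: "norm (m_off \<Omega> p \<zeta>0 (P s)) \<le> C * s"
      using lip[of "of_real s"] s by (simp add: \<epsilon>'_def)
    have "(c * s) ^ b \<le> norm (K (P s) \<zeta>0) ^ b"
      using Ps(2) c(1) s by (intro power_mono) auto
    also have "\<dots> = norm (K \<zeta>0 (P s) ^ b)"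
      using K_cnj[OF \<zeta>0 Ps(1)] by (simp add: norm_power)
    also have "\<dots> = norm (m_off \<Omega> p \<zeta>0 (P s)) ^ a * norm (K (P s) (P s)) ^ b"
      unfolding eq[OF Ps(1), symmetric] by (simp add: norm_mult norm_power)
    also have "\<dots> \<le> (C * s) ^ a * D ^ b"
      using Fs KD C s by (intro mult_mono power_mono) auto
    finally show "c ^ b * s ^ b \<le> C ^ a * D ^ b * s ^ a"
      by (simp add: power_mult_distrib mult_ac)
  qed (use c \<rho> r in \<open>auto simp: \<epsilon>'_def\<close>)
  with ba show False by simp
qed

end

theorem theorem1p1:
  fixes \<Omega> :: "(complex ^ 'n) set"
  assumes "open \<Omega>" and "connected \<Omega>" and "\<Omega> \<noteq> {}" and "bounded \<Omega>"
    and "complete_reinhardt \<Omega>"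
  shows
    "((\<exists>z\<in>\<Omega>. \<exists>w\<in>\<Omega>. K_off \<Omega> 2 z w = 0) \<longrightarrow>
        (\<exists>k0::nat. k0 > 0 \<and> (\<forall>k::nat. k \<ge> k0 \<longrightarrow>
           \<not> (\<lambda>z. K_diag \<Omega> (2 * real k) z) real_analytic_on \<Omega>)))
     \<and>
     (\<forall>\<zeta>0\<in>\<Omega>. \<forall>z0\<in>\<Omega>.
        K_off \<Omega> 2 \<zeta>0 z0 = 0 \<and> vanishing_order (\<lambda>w. cnj (K_off \<Omega> 2 \<zeta>0 w)) z0 = 1 \<longrightarrow>
          (\<forall>k::nat. k > 2 \<longrightarrow> \<not> (\<lambda>z. K_diag \<Omega> (2 * real k) z) real_analytic_on \<Omega>)
          \<and> (\<forall>p::real. p \<in> \<rat> \<and> p > 2 \<longrightarrow>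
               \<not> (\<lambda>z. Re (m_off \<Omega> p \<zeta>0 z)) real_analytic_on \<Omega>
               \<or> \<not> (\<lambda>z. Im (m_off \<Omega> p \<zeta>0 z)) real_analytic_on \<Omega>))"
proof -
  interpret balanced_domain \<Omega>
  proof
    fix z and u :: complex assume "z \<in> \<Omega>" "norm u \<le> 1"
    then show "u *s z \<in> \<Omega>"
      using assms(5) mult_right_mono[of "norm u" 1] unfolding complete_reinhardt_def
      by (auto simp: norm_mult)
  qed (use assms in auto)
  show ?thesis
  proof (intro conjI impI ballI allI)
    assume "\<exists>z\<in>\<Omega>. \<exists>w\<in>\<Omega>. K_off \<Omega> 2 z w = 0"
    then show "\<exists>k0::nat. k0 > 0 \<and> (\<forall>k::nat. k \<ge> k0 \<longrightarrow>
           \<not> (\<lambda>z. K_diag \<Omega> (2 * real k) z) real_analytic_on \<Omega>)"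
      using eventually_not_real_analytic by (auto simp: K_off_eq)
  next
    fix \<zeta>0 z0 and k :: nat
    assume "\<zeta>0 \<in> \<Omega>" "z0 \<in> \<Omega>" "2 < k"
      "K_off \<Omega> 2 \<zeta>0 z0 = 0 \<and> vanishing_order (\<lambda>w. cnj (K_off \<Omega> 2 \<zeta>0 w)) z0 = 1"
    then show "\<not> (\<lambda>z. K_diag \<Omega> (2 * real k) z) real_analytic_on \<Omega>"
      using not_real_analytic_of_simple_zero[of \<zeta>0 z0 k] by (simp add: K_off_eq[of \<zeta>0 z0])
  next
    fix \<zeta>0 z0 and p :: real
    assume "\<zeta>0 \<in> \<Omega>" "z0 \<in> \<Omega>" "p \<in> \<rat> \<and> 2 < p"
      "K_off \<Omega> 2 \<zeta>0 z0 = 0 \<and> vanishing_order (\<lambda>w. cnj (K_off \<Omega> 2 \<zeta>0 w)) z0 = 1"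
    then show "\<not> (\<lambda>z. Re (m_off \<Omega> p \<zeta>0 z)) real_analytic_on \<Omega>
               \<or> \<not> (\<lambda>z. Im (m_off \<Omega> p \<zeta>0 z)) real_analytic_on \<Omega>"
      using m_off_not_real_analytic[of \<zeta>0 z0 p] by (simp add: K_off_eq[of \<zeta>0 z0])
  qed
qed

end
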